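(* Let $\Gamma$ and $\Gamma^*$ be adjoint nilpotent operators in a Hilbert space $\mathcal H$, i.e. $\Gamma^2=(\Gamma^* )^2=0$, and let $B_1,B_2$ be bounded operators on $\mathcal H$ such that $B_1$ is strictly accretive on $\mathsf R(\Gamma^* )$ and $B_2$ is strictly accretive on $\mathsf R(\Gamma)$. Assume furthermore that $\Gamma^*B_2B_1\Gamma^*=0$ and $\Gamma B_1B_2\Gamma=0$. Let $$\Pi_B:=\Gamma+B_1\Gamma^*B_2\ \text{ on }\mathcal H,\qquad D:=\begin{bmatrix}0&\Gamma^*\\ \Gamma&0\end{bmatrix},\quad B:=\begin{bmatrix}B_1&0\\0&B_2\end{bmatrix}\ \text{ on }\mathcal H\oplus\mathcal H.$$ Then $\Pi_B$ is a bisectorial operator on $\mathcal H$ with resolvent bounds. Furthermore, if $BD$ satisfies quadratic estimates (in $\mathcal H\oplus\mathcal H$), so does $\Pi_B$ (in $\mathcal H$).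
   Context: $\Gamma$ is a closed densely defined (unbounded) operator with adjoint $\Gamma^*$; $\mathsf R(\cdot)$ denotes the range. An operator $B_i$ is strictly accretive on a subspace $V$ if there is $\delta>0$ with $\mathrm{Re}(B_iv,v)\ge\delta\|v\|^2$ for all $v\in V$. An operator $T$ is bisectorial with resolvent bounds if for some $\omega\in[0,\pi/2)$, with $S_\omega:=\{z\in\mathbf C:|\arg z|\le\omega\text{ or }|\arg(-z)|\le\omega\}\cup\{0\}$, one has $\sigma(T)\subset S_\omega$ and $\|(\lambda I-T)^{-1}\|\lesssim1/\mathrm{dist}(\lambda,S_\omega)$ for $\lambda\notin S_\omega$. A bisectorial operator $T$ satisfies quadratic estimates if $\int_0^\infty\|tT(I+t^2T^2)^{-1}u\|^2\,\frac{dt}t\lesssim\|u\|^2$ for all $u$ in the space. *)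

theory Defs
  imports "HOL-Analysis.Analysis"
begin

section \<open>Complex Hilbert spaces\<close>

class scaleC =
  fixes scaleC :: "complex \<Rightarrow> 'a \<Rightarrow> 'a"  (infixr \<open>*\<^sub>C\<close> 75)

class complex_vector = scaleC + ab_group_add +
  assumes scaleC_add_right: "a *\<^sub>C (x + y) = a *\<^sub>C x + a *\<^sub>C y"
    and scaleC_add_left: "(a + b) *\<^sub>C x = a *\<^sub>C x + b *\<^sub>C x"
    and scaleC_scaleC: "a *\<^sub>C (b *\<^sub>C x) = (a * b) *\<^sub>C x"
    and scaleC_one: "1 *\<^sub>C x = x"

interpretation complex_vector: vector_space "scaleC :: complex \<Rightarrow> 'a \<Rightarrow> 'a::complex_vector"
  by unfold_locales (fact scaleC_add_right scaleC_add_left scaleC_scaleC scaleC_one)+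

text \<open>
  The complex inner product is linear in its first argument.  Its real part is the inner product
  of the underlying real inner product space, so that norm and topology are those of
  \<^class>\<open>real_inner\<close>, and positive definiteness of \<open>cinner\<close> is inherited from it.
\<close>

class complex_inner = complex_vector + real_inner +
  fixes cinner :: "'a \<Rightarrow> 'a \<Rightarrow> complex"
  assumes scaleR_eq_scaleC: "r *\<^sub>R x = complex_of_real r *\<^sub>C x"
    and cinner_commute: "cinner x y = cnj (cinner y x)"
    and cinner_add_left: "cinner (x + y) z = cinner x z + cinner y z"
    and cinner_scaleC_left: "cinner (a *\<^sub>C x) y = a * cinner x y"
    and Re_cinner: "Re (cinner x y) = inner x y"

class complex_hilbert = complex_inner + complete_space

instantiation complex :: complex_hilbert
begin
definition "scaleC a (x :: complex) = a * x"
definition "cinner x (y :: complex) = x * cnj y"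
instance
  by standard
    (auto simp: scaleC_complex_def cinner_complex_def algebra_simps scaleR_conv_of_real
       inner_complex_def)
end

instantiation prod :: (complex_vector, complex_vector) complex_vector
begin
definition "scaleC a (p :: 'a \<times> 'b) = (a *\<^sub>C fst p, a *\<^sub>C snd p)"
instance
  by standard
    (auto simp: scaleC_prod_def scaleC_add_right scaleC_add_left scaleC_scaleC scaleC_one)
end

instantiation prod :: (complex_inner, complex_inner) complex_inner
begin
definition "cinner p (q :: 'a \<times> 'b) = cinner (fst p) (fst q) + cinner (snd p) (snd q)"
instance
proof
  fix p q :: "'a \<times> 'b"
  show "cinner p q = cnj (cinner q p)"
    unfolding cinner_prod_def complex_cnj_add
    by (simp only: cinner_commute [of "fst p"] cinner_commute [of "snd p"])
qed (auto simp: cinner_prod_def scaleC_prod_def scaleR_prod_def scaleR_eq_scaleC cinner_add_left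
       cinner_scaleC_left Re_cinner inner_prod_def algebra_simps)
end

instance prod :: (complex_hilbert, complex_hilbert) complex_hilbert ..

section \<open>Unbounded operators\<close>

text \<open>
  A (possibly unbounded) operator is represented by its graph.  Thus its domain and range are
  \<^const>\<open>Domain\<close> and \<^const>\<open>Range\<close>, its inverse is \<^const>\<open>converse\<close>, the identity operator is
  \<^const>\<open>Id\<close>, and sums and compositions automatically carry their natural maximal domains.
\<close>

definition linear_operator :: "'a::complex_vector rel \<Rightarrow> bool" where
  "linear_operator T \<longleftrightarrow> complex_vector.subspace T \<and> single_valued T"

definition closed_densely_defined :: "'a::complex_inner rel \<Rightarrow> bool" where
  "closed_densely_defined T \<longleftrightarrow> linear_operator T \<and> closed T \<and> closure (Domain T) = UNIV"

text \<open>\<open>bounded_operator B\<close>: \<open>B\<close> is bounded, complex linear and everywhere defined.\<close>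

definition bounded_operator :: "('a::complex_inner \<Rightarrow> 'a) \<Rightarrow> bool" where
  "bounded_operator B \<longleftrightarrow> Vector_Spaces.linear scaleC scaleC B \<and> (\<exists>K. \<forall>x. norm (B x) \<le> K * norm x)"

definition op_of :: "('a \<Rightarrow> 'a) \<Rightarrow> 'a rel" where
  "op_of B = {(x, B x) | x. True}"

text \<open>Only meaningful for single-valued \<open>T\<close> and \<open>x\<close> in the domain of \<open>T\<close>.\<close>

definition op_app :: "'a rel \<Rightarrow> 'a \<Rightarrow> 'a" where
  "op_app T x = (THE y. (x, y) \<in> T)"

definition op_add :: "'a::plus rel \<Rightarrow> 'a rel \<Rightarrow> 'a rel"  (infixl \<open>\<oplus>\<^sub>o\<close> 65) where
  "S \<oplus>\<^sub>o T = {(x, y + z) | x y z. (x, y) \<in> S \<and> (x, z) \<in> T}"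

definition op_diff :: "'a::minus rel \<Rightarrow> 'a rel \<Rightarrow> 'a rel"  (infixl \<open>\<ominus>\<^sub>o\<close> 65) where
  "S \<ominus>\<^sub>o T = {(x, y - z) | x y z. (x, y) \<in> S \<and> (x, z) \<in> T}"

definition op_scale :: "complex \<Rightarrow> 'a::scaleC rel \<Rightarrow> 'a rel"  (infixr \<open>\<cdot>\<^sub>o\<close> 75) where
  "c \<cdot>\<^sub>o T = {(x, c *\<^sub>C y) | x y. (x, y) \<in> T}"

text \<open>\<open>S \<circ>\<^sub>o T\<close> applies \<open>T\<close> first, whereas \<^const>\<open>relcomp\<close> applies its left argument first.\<close>

definition op_comp :: "'a rel \<Rightarrow> 'a rel \<Rightarrow> 'a rel"  (infixr \<open>\<circ>\<^sub>o\<close> 70) where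
  "S \<circ>\<^sub>o T = T O S"

definition op_adjoint :: "'a::complex_inner rel \<Rightarrow> 'a rel" where
  "op_adjoint T = {(y, z). \<forall>(x, w) \<in> T. cinner w y = cinner x z}"

text \<open>
  The zero operator with domain \<open>V\<close>.  For unbounded \<open>S\<close> and \<open>T\<close>, the equation \<open>S A T = 0\<close> is
  understood on the whole domain of \<open>T\<close>, that is, \<open>A\<close> maps the range of \<open>T\<close> into the null space
  of \<open>S\<close>.  It would not suffice that \<open>S A T\<close> vanishes on its own domain, which may be trivial.
\<close>

definition zero_on :: "'a set \<Rightarrow> 'a::zero rel" where
  "zero_on V = V \<times> {0}"

text \<open>The block operator matrix with rows \<open>(S\<^sub>1, S\<^sub>2)\<close> and \<open>(S\<^sub>3, S\<^sub>4)\<close> on the direct sum.\<close>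

definition op_block :: "'a::plus rel \<Rightarrow> 'a rel \<Rightarrow> 'a rel \<Rightarrow> 'a rel \<Rightarrow> ('a \<times> 'a) rel" where
  "op_block S\<^sub>1 S\<^sub>2 S\<^sub>3 S\<^sub>4 =
     {((x, y), (a + b, c + d)) | x y a b c d.
        (x, a) \<in> S\<^sub>1 \<and> (y, b) \<in> S\<^sub>2 \<and> (x, c) \<in> S\<^sub>3 \<and> (y, d) \<in> S\<^sub>4}"

definition strictly_accretive_on :: "('a::complex_inner \<Rightarrow> 'a) \<Rightarrow> 'a set \<Rightarrow> bool" where
  "strictly_accretive_on B V \<longleftrightarrow> (\<exists>\<delta>>0. \<forall>v\<in>V. Re (cinner (B v) v) \<ge> \<delta> * (norm v)\<^sup>2)"

section \<open>Bisectorial operators and quadratic estimates\<close>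

definition resolvent_set :: "'a::complex_inner rel \<Rightarrow> complex set" where
  "resolvent_set T = {z. \<exists>R. bounded_operator R \<and> (z \<cdot>\<^sub>o Id \<ominus>\<^sub>o T)\<inverse> = op_of R}"

definition spectrum :: "'a::complex_inner rel \<Rightarrow> complex set" where
  "spectrum T = - resolvent_set T"

definition resolvent :: "'a::complex_inner rel \<Rightarrow> complex \<Rightarrow> 'a \<Rightarrow> 'a" where
  "resolvent T z = op_app ((z \<cdot>\<^sub>o Id \<ominus>\<^sub>o T)\<inverse>)"

definition bisector :: "real \<Rightarrow> complex set" where
  "bisector \<omega> = {z. \<bar>Arg z\<bar> \<le> \<omega> \<or> \<bar>Arg (- z)\<bar> \<le> \<omega>} \<union> {0}"

definition bisectorial :: "'a::complex_inner rel \<Rightarrow> bool" where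
  "bisectorial T \<longleftrightarrow> linear_operator T \<and>
     (\<exists>\<omega>. 0 \<le> \<omega> \<and> \<omega> < pi / 2 \<and> spectrum T \<subseteq> bisector \<omega> \<and>
       (\<exists>C. \<forall>z. z \<notin> bisector \<omega> \<longrightarrow>
          onorm (resolvent T z) \<le> C / infdist z (bisector \<omega>)))"

text \<open>
  For bisectorial \<open>T\<close> and \<open>t > 0\<close> the operator below is everywhere defined, since
  \<open>\<i>/t\<close> and \<open>-\<i>/t\<close> lie in the resolvent set.
\<close>

definition quadratic_op :: "'a::complex_inner rel \<Rightarrow> real \<Rightarrow> 'a \<Rightarrow> 'a" where
  "quadratic_op T t =
     op_app ((of_real t \<cdot>\<^sub>o T) \<circ>\<^sub>o (Id \<oplus>\<^sub>o of_real (t\<^sup>2) \<cdot>\<^sub>o (T \<circ>\<^sub>o T))\<inverse>)"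

definition quadratic_estimates :: "'a::complex_inner rel \<Rightarrow> bool" where
  "quadratic_estimates T \<longleftrightarrow> bisectorial T \<and>
     (\<exists>C. \<forall>u. (\<integral>\<^sup>+t\<in>{0<..}. ennreal ((norm (quadratic_op T t u))\<^sup>2 / t) \<partial>lborel)
                 \<le> ennreal (C * (norm u)\<^sup>2))"

end

theory Submission
  imports Defs
begin

text \<open>
  The resolvent of \<open>\<Pi>\<^sub>B\<close> can be read off from that of \<open>BD\<close>.  Writing out
  \<open>(z - BD)(x, y) = (f, B\<^sub>2 f)\<close> gives \<open>z x = f + B\<^sub>1\<Gamma>\<^sup>*y\<close> and \<open>z y = B\<^sub>2(f + \<Gamma>x)\<close>.  Put
  \<open>u = x + z\<^sup>-\<^sup>1\<Gamma>x\<close>.  Since \<open>\<Gamma>\<^sup>2 = 0\<close>, \<open>\<Gamma>u = \<Gamma>x\<close>; since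
  \<open>B\<^sub>2u = y + z\<^sup>-\<^sup>1B\<^sub>2B\<^sub>1\<Gamma>\<^sup>*y\<close> and \<open>\<Gamma>\<^sup>*B\<^sub>2B\<^sub>1\<Gamma>\<^sup>* = 0\<close>, also \<open>\<Gamma>\<^sup>*B\<^sub>2u = \<Gamma>\<^sup>*y\<close>.  Hence
  \<open>(z - \<Pi>\<^sub>B)u = z x + \<Gamma>x - \<Gamma>x - B\<^sub>1\<Gamma>\<^sup>*y = f\<close>.  The substitution can be inverted, and this bounds \<open>u\<close>
  by \<open>x\<close> and \<open>\<Gamma>x\<close>.  The squares behave in the same way: if
  \<open>(1 + t\<^sup>2(BD)\<^sup>2)(x, y) = (f, B\<^sub>2 f)\<close>, then \<open>t\<Pi>\<^sub>B(1 + t\<^sup>2\<Pi>\<^sub>B\<^sup>2)\<^sup>-\<^sup>1f = t\<Gamma>x + tB\<^sub>1\<Gamma>\<^sup>*y\<close>, whereas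
  \<open>tBD(1 + t\<^sup>2(BD)\<^sup>2)\<^sup>-\<^sup>1(f, B\<^sub>2f) = (tB\<^sub>1\<Gamma>\<^sup>*y, tB\<^sub>2\<Gamma>x)\<close>.  As \<open>B\<^sub>2\<close> is bounded below on the range of
  \<open>\<Gamma>\<close>, the first is dominated by the second for each \<open>t\<close> separately, so that quadratic estimates
  for \<open>BD\<close> pass to \<open>\<Pi>\<^sub>B\<close> under the integral sign.

  It remains to see that \<open>z - BD\<close> is onto, with bounds, outside a double sector.  With
  \<open>(z - BD)u = f\<close>, pairing with \<open>Du\<close> yields \<open>z (u, Du) = (BDu, Du) + (f, Du)\<close>, where
  \<open>(u, Du)\<close> is real because \<open>D\<close> is symmetric and \<open>(BDu, Du)\<close> lies in a closed sector about the
  positive axis because \<open>B\<close> is accretive on the range of \<open>D\<close>.  For \<open>z\<close> steep enough these two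
  constraints bound \<open>Du\<close> by \<open>f\<close> (\<open>accretive_estimate\<close>).  The bound is uniform along the segment from
  \<open>(\<plusminus>\<i>, I)\<close> to \<open>(z, B)\<close>, so surjectivity propagates along it
  (\<open>method_of_continuity\<close>, \<open>accretive_perturbation_onto\<close>).  At its starting point, solving
  \<open>(\<plusminus>\<i> - D)u = F\<close> is orthogonal projection in \<open>H \<oplus> H\<close> onto the graph of \<open>\<Gamma>\<close>, whose complement is
  the rotated graph of \<open>\<Gamma>\<^sup>*\<close> (\<open>D_onto\<close>).
\<close>

section \<open>Complex inner products\<close>

lemma cinner_add_right: "cinner x (y + z) = cinner x y + cinner x (z::'a::complex_inner)"
  by (metis cinner_add_left cinner_commute complex_cnj_add)

lemma cinner_scaleC_right: "cinner x (a *\<^sub>C y) = cnj a * cinner x (y::'a::complex_inner)"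
  by (metis cinner_scaleC_left cinner_commute complex_cnj_mult)

lemma cinner_minus_left: "cinner (- x) y = - cinner x (y::'a::complex_inner)"
  by (metis add_eq_0_iff cinner_add_left add.right_neutral add_0 add_right_imp_eq ab_left_minus)

lemma cinner_minus_right: "cinner x (- y) = - cinner x (y::'a::complex_inner)"
  by (metis cinner_commute cinner_minus_left complex_cnj_minus)

lemma cinner_zero_right: "cinner x 0 = (0 :: complex)" for x :: "'a::complex_inner"
  using cinner_add_right [of x 0 0] by simp

lemma cinner_diff_left: "cinner (x - y) z = cinner x z - cinner y (z::'a::complex_inner)"
  by (metis cinner_add_left cinner_minus_left add_uminus_conv_diff)

lemma norm_scaleC: "norm (a *\<^sub>C x) = cmod a * norm (x::'a::complex_inner)"
proof -
  have "(norm (a *\<^sub>C x))\<^sup>2 = Re (cinner (a *\<^sub>C x) (a *\<^sub>C x))"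
    by (simp add: Re_cinner power2_norm_eq_inner)
  also have "\<dots> = Re ((a * cnj a) * cinner x x)"
    by (simp only: cinner_scaleC_left cinner_scaleC_right mult_ac)
  also have "\<dots> = (cmod a * norm x)\<^sup>2"
    by (simp only: complex_norm_square [symmetric] of_real_power [symmetric]
        Re_complex_of_real power_mult_distrib Re_cinner power2_norm_eq_inner)
      (simp add: Re_cinner power2_norm_eq_inner power_mult_distrib)
  finally show ?thesis
    by (simp add: power2_eq_iff_nonneg)
qed

lemma norm_cinner_le: "cmod (cinner x y) \<le> norm x * norm (y::'a::complex_inner)"
proof (cases "cinner x y = 0")
  case False
  \<comment> \<open>Rotating \<open>x\<close> makes the product real and reduces the claim to the real inner product.\<close>
  define a where "a = cnj (sgn (cinner x y))"
  have a: "cmod a = 1"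
    using False by (simp add: a_def norm_sgn)
  have "a * cinner x y = complex_of_real (cmod (cinner x y))"
    using False
    by (simp add: a_def sgn_div_norm scaleR_conv_of_real field_simps power2_eq_square
        complex_norm_square [symmetric])
  then have "cmod (cinner x y) = inner (a *\<^sub>C x) y"
    by (metis Re_cinner Re_complex_of_real cinner_scaleC_left)
  also have "\<dots> \<le> norm (a *\<^sub>C x) * norm y"
    by (rule norm_cauchy_schwarz)
  finally show ?thesis
    by (simp add: norm_scaleC a)
qed auto

lemma subspace_if_complex_subspace:
  "complex_vector.subspace V \<Longrightarrow> subspace (V :: 'a::complex_inner set)"
  unfolding complex_vector.subspace_def subspace_def by (simp add: scaleR_eq_scaleC)

section \<open>Orthogonal projection\<close>

lemma exists_nearest_point:
  fixes V :: "'a::{real_inner, complete_space} set"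
  assumes "subspace V" "closed V"
  obtains p where "p \<in> V" "\<And>v. v \<in> V \<Longrightarrow> norm (x - p) \<le> norm (x - v)"
proof -
  define d where "d = infdist x V"
  have ne: "V \<noteq> {}" using assms(1) subspace_0 by blast
  have d_le: "d \<le> norm (x - v)" if "v \<in> V" for v
    using infdist_le [OF that, of x] by (simp add: d_def dist_norm)
  have d0: "0 \<le> d" by (simp add: d_def infdist_nonneg)
  have "\<exists>v\<in>V. norm (x - v) < d + inverse (real (Suc n))" for n
  proof (rule ccontr)
    assume "\<not> ?thesis"
    then have "d + inverse (real (Suc n)) \<le> infdist x V"
      unfolding infdist_notempty [OF ne]
      by (intro cINF_greatest [OF ne]) (auto simp: dist_norm not_less)
    then show False by (simp add: d_def)
  qed
  then obtain v where v: "\<And>n. v n \<in> V" "\<And>n. norm (x - v n) < d + inverse (real (Suc n))"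
    by metis
  have lim: "(\<lambda>n. norm (x - v n)) \<longlonglongrightarrow> d"
  proof (rule tendsto_sandwich [where f = "\<lambda>_. d"])
    show "(\<lambda>n. d + inverse (real (Suc n))) \<longlonglongrightarrow> d"
      using tendsto_add [OF tendsto_const LIMSEQ_inverse_real_of_nat] by simp
  qed (use v d_le in \<open>auto intro!: always_eventually less_imp_le simp del: of_nat_Suc\<close>)
  \<comment> \<open>By the parallelogram law, a minimising sequence is Cauchy: midpoints are no nearer than \<open>d\<close>.\<close>
  have par: "(norm (v m - v n))\<^sup>2 \<le> 2 * (norm (x - v m))\<^sup>2 + 2 * (norm (x - v n))\<^sup>2 - 4 * d\<^sup>2"
    for m n
  proof -
    have "(1 / 2) *\<^sub>R (v m + v n) \<in> V"
      by (intro subspace_mul subspace_add assms v)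
    from d_le [OF this] have "d\<^sup>2 \<le> (norm (x - (1 / 2) *\<^sub>R (v m + v n)))\<^sup>2"
      using d0 by (intro power_mono) auto
    moreover have "(norm (v m - v n))\<^sup>2 + 4 * (norm (x - (1 / 2) *\<^sub>R (v m + v n)))\<^sup>2
        = 2 * (norm (x - v m))\<^sup>2 + 2 * (norm (x - v n))\<^sup>2"
      by (simp add: power2_norm_eq_inner inner_diff_left inner_diff_right inner_add_left
          inner_add_right inner_commute algebra_simps)
    ultimately show ?thesis by simp
  qed
  have "Cauchy v"
  proof (rule metric_CauchyI)
    fix e :: real assume e: "0 < e"
    have "(\<lambda>n. (norm (x - v n))\<^sup>2) \<longlonglongrightarrow> d\<^sup>2"
      by (intro tendsto_intros lim)
    moreover have "d\<^sup>2 < d\<^sup>2 + e\<^sup>2 / 4" using e by simp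
    ultimately have "\<forall>\<^sub>F n in sequentially. (norm (x - v n))\<^sup>2 < d\<^sup>2 + e\<^sup>2 / 4"
      by (rule order_tendstoD)
    then obtain N where N: "\<And>n. n \<ge> N \<Longrightarrow> (norm (x - v n))\<^sup>2 < d\<^sup>2 + e\<^sup>2 / 4"
      by (auto simp: eventually_sequentially)
    have "dist (v m) (v n) < e" if "m \<ge> N" "n \<ge> N" for m n
    proof -
      have "(norm (v m - v n))\<^sup>2 < e\<^sup>2"
        using par [of m n] N [OF that(1)] N [OF that(2)] by linarith
      then show ?thesis
        using e by (metis dist_norm power2_less_imp_less less_imp_le)
    qed
    then show "\<exists>N. \<forall>m\<ge>N. \<forall>n\<ge>N. dist (v m) (v n) < e" by blast
  qed
  then obtain p where p: "v \<longlonglongrightarrow> p"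
    using Cauchy_convergent convergent_def by blast
  show thesis
  proof
    show "p \<in> V"
      using assms(2) v(1) p by (rule closed_sequentially)
    have "(\<lambda>n. norm (x - v n)) \<longlonglongrightarrow> norm (x - p)"
      by (intro tendsto_intros p)
    then have "norm (x - p) = d"
      using lim LIMSEQ_unique by blast
    then show "norm (x - p) \<le> norm (x - w)" if "w \<in> V" for w
      using d_le [OF that] by simp
  qed
qed

lemma exists_orthogonal_projection:
  fixes V :: "'a::complex_hilbert set"
  assumes V: "complex_vector.subspace V" and "closed V"
  obtains p where "p \<in> V" "\<And>v. v \<in> V \<Longrightarrow> cinner (x - p) v = 0"
proof -
  note sub = subspace_if_complex_subspace [OF V]
  obtain p where p: "p \<in> V" "\<And>v. v \<in> V \<Longrightarrow> norm (x - p) \<le> norm (x - v)"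
    using exists_nearest_point [OF sub assms(2)] by metis
  have orth: "inner (x - p) v = 0" if v: "v \<in> V" for v
  proof (rule ccontr)
    assume ne: "inner (x - p) v \<noteq> 0"
    then have v0: "v \<noteq> 0" by auto
    \<comment> \<open>Moving from \<open>p\<close> by the component of \<open>x - p\<close> along \<open>v\<close> would come nearer to \<open>x\<close>.\<close>
    define t where "t = inner (x - p) v / inner v v"
    have "norm (x - p) \<le> norm (x - (p + t *\<^sub>R v))"
      by (intro p subspace_add subspace_mul sub v)
    then have "(norm (x - p))\<^sup>2 \<le> (norm ((x - p) - t *\<^sub>R v))\<^sup>2"
      by (simp add: diff_diff_eq power_mono)
    also have "\<dots> = (norm (x - p))\<^sup>2 - 2 * t * inner (x - p) v + t * t * inner v v"
      by (simp add: power2_norm_eq_inner inner_diff_left inner_diff_right inner_commute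
          algebra_simps)
    also have "\<dots> = (norm (x - p))\<^sup>2 - (inner (x - p) v)\<^sup>2 / inner v v"
      using v0 by (simp add: t_def field_simps power2_eq_square)
    finally have "(inner (x - p) v)\<^sup>2 / inner v v \<le> 0" by simp
    moreover have "(inner (x - p) v)\<^sup>2 / inner v v > 0"
      using ne v0 by simp
    ultimately show False by simp
  qed
  show thesis
  proof
    fix v assume v: "v \<in> V"
    \<comment> \<open>Real orthogonality to \<open>\<i> v\<close> is the vanishing of the imaginary part at \<open>v\<close>.\<close>
    have "\<i> *\<^sub>C v \<in> V"
      using V v by (simp add: complex_vector.subspace_def)
    from orth [OF this] have "Im (cinner (x - p) v) = 0"
      by (simp add: Re_cinner [symmetric] cinner_scaleC_right)
    with orth [OF v] show "cinner (x - p) v = 0"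
      by (simp add: complex_eq_iff Re_cinner)
  qed (rule p)
qed

section \<open>The method of continuity\<close>

text \<open>
  Wherever the interpolated map is onto, the difference \<open>L\<^sub>1 - L\<^sub>0\<close> composed with a right inverse
  of it is Lipschitz with constant \<open>K\<close>, so a contraction argument moves the parameter by
  \<open>1 / (2 K)\<close>; finitely many such steps lead from \<open>L\<^sub>0\<close> to \<open>L\<^sub>1\<close>.  Since the estimate compares only
  values of the maps, the domain carries no norm, and it can be the graph of an unbounded operator.
\<close>

lemma method_of_continuity:
  fixes L\<^sub>0 L\<^sub>1 :: "'b::real_vector \<Rightarrow> 'c::{real_normed_vector, complete_space}"
  assumes lin: "linear L\<^sub>0" "linear L\<^sub>1" and V: "subspace V"
    and est: "\<And>s v. 0 \<le> s \<Longrightarrow> s \<le> 1 \<Longrightarrow> v \<in> V \<Longrightarrow>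
      norm (L\<^sub>1 v - L\<^sub>0 v) \<le> K * norm ((1 - s) *\<^sub>R L\<^sub>0 v + s *\<^sub>R L\<^sub>1 v)"
    and onto: "L\<^sub>0 ` V = UNIV"
  shows "L\<^sub>1 ` V = UNIV"
proof -
  define L where "L s v = (1 - s) *\<^sub>R L\<^sub>0 v + s *\<^sub>R L\<^sub>1 v" for s v
  \<comment> \<open>A positive constant is needed below to choose the number of steps.\<close>
  define K' where "K' = max K 1"
  have K': "K' \<ge> 1" "K \<le> K'" by (auto simp: K'_def)
  have est': "norm (L\<^sub>1 v - L\<^sub>0 v) \<le> K' * norm (L s v)" if "0 \<le> s" "s \<le> 1" "v \<in> V" for s v
    using est [OF that] mult_right_mono [OF K'(2), of "norm (L s v)"] by (auto simp: L_def)
  have L_diff: "L s (v - w) = L s v - L s w" for s v w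
    by (simp add: L_def linear_diff [OF lin(1)] linear_diff [OF lin(2)] algebra_simps)
  have step: "L s ` V = UNIV"
    if s0: "0 \<le> s0" "s0 \<le> 1" and close: "\<bar>s - s0\<bar> * K' \<le> 1 / 2" and ont: "L s0 ` V = UNIV"
    for s s0
  proof -
    have "\<exists>v\<in>V. L s0 v = g" for g
      using ont by (metis UNIV_I imageE)
    \<comment> \<open>The right inverse \<open>R\<close> is not assumed linear: by \<open>est'\<close>, the values of \<open>L\<^sub>1 - L\<^sub>0\<close> on \<open>V\<close> depend
      on those of \<open>L s0\<close> only.\<close>
    then obtain R where R: "\<And>g. R g \<in> V" "\<And>g. L s0 (R g) = g" by metis
    have "f \<in> L s ` V" for f
    proof -
      define \<Phi> where "\<Phi> g = f - (s - s0) *\<^sub>R (L\<^sub>1 (R g) - L\<^sub>0 (R g))" for g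
      have "dist (\<Phi> g) (\<Phi> h) \<le> 1 / 2 * dist g h" for g h
      proof -
        have "norm (L\<^sub>1 (R g - R h) - L\<^sub>0 (R g - R h)) \<le> K' * norm (L s0 (R g - R h))"
          by (intro est' s0 subspace_diff V R)
        then have *: "norm (L\<^sub>1 (R g - R h) - L\<^sub>0 (R g - R h)) \<le> K' * norm (g - h)"
          by (simp add: L_diff R)
        have "\<Phi> g - \<Phi> h = - ((s - s0) *\<^sub>R (L\<^sub>1 (R g - R h) - L\<^sub>0 (R g - R h)))"
          by (simp add: \<Phi>_def linear_diff [OF lin(1)] linear_diff [OF lin(2)] algebra_simps)
        then have "dist (\<Phi> g) (\<Phi> h) = \<bar>s - s0\<bar> * norm (L\<^sub>1 (R g - R h) - L\<^sub>0 (R g - R h))"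
          by (simp add: dist_norm)
        also have "\<dots> \<le> \<bar>s - s0\<bar> * (K' * norm (g - h))"
          by (intro mult_left_mono *) auto
        also have "\<dots> \<le> 1 / 2 * norm (g - h)"
          using mult_right_mono [OF close, of "norm (g - h)"] by (simp add: mult.assoc)
        finally show ?thesis by (simp add: dist_norm)
      qed
      then have "\<exists>!g. \<Phi> g = g"
        by (intro banach_fix_type [where c = "1 / 2"]) auto
      then obtain g where g: "\<Phi> g = g" by blast
      have "L s (R g) = L s0 (R g) + (s - s0) *\<^sub>R (L\<^sub>1 (R g) - L\<^sub>0 (R g))"
        by (simp add: L_def algebra_simps)
      also have "\<dots> = f"
        using g by (simp add: R \<Phi>_def algebra_simps)
      finally show ?thesis using R(1) by blast
    qed
    then show ?thesis by blast
  qed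
  define N where "N = nat \<lceil>2 * K'\<rceil>"
  have N: "2 * K' \<le> real N" "0 < real N"
    using K' by (auto simp: N_def real_nat_ceiling_ge)
  have "L (real n / real N) ` V = UNIV" if "n \<le> N" for n
    using that
  proof (induction n)
    case 0
    then show ?case using onto by (simp add: L_def image_def)
  next
    case (Suc n)
    show ?case
    proof (rule step)
      show "\<bar>real (Suc n) / real N - real n / real N\<bar> * K' \<le> 1 / 2"
        using N by (simp add: diff_divide_distrib [symmetric] field_simps)
    qed (use Suc N in auto)
  qed
  from this [of N] N show ?thesis by (simp add: L_def image_def)
qed

section \<open>Linear and bisectorial operators\<close>

lemma linear_operator_add:
  "linear_operator T \<Longrightarrow> (x, y) \<in> T \<Longrightarrow> (x', y') \<in> T \<Longrightarrow> (x + x', y + y') \<in> T"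
  unfolding linear_operator_def complex_vector.subspace_def by fastforce

lemma linear_operator_scale:
  "linear_operator T \<Longrightarrow> (x, y) \<in> T \<Longrightarrow> (a *\<^sub>C x, a *\<^sub>C y) \<in> T"
  unfolding linear_operator_def complex_vector.subspace_def by (fastforce simp: scaleC_prod_def)

lemma linear_operator_diff:
  assumes "linear_operator T" "(x, y) \<in> T" "(x', y') \<in> T"
  shows "(x - x', y - y') \<in> T"
  using linear_operator_add [OF assms(1,2) linear_operator_scale [OF assms(1,3), of "- 1"]]
  by (simp add: complex_vector.scale_minus_left scaleC_one)

lemma linear_operator_zero: "linear_operator T \<Longrightarrow> (0, 0) \<in> T"
  unfolding linear_operator_def complex_vector.subspace_def by (auto simp: zero_prod_def)

lemma linear_operator_unique:
  "linear_operator T \<Longrightarrow> (x, y) \<in> T \<Longrightarrow> (x, y') \<in> T \<Longrightarrow> y = y'"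
  unfolding linear_operator_def single_valued_def by blast

lemma linear_operatorI:
  assumes "\<And>x y x' y'. (x, y) \<in> T \<Longrightarrow> (x', y') \<in> T \<Longrightarrow> (x + x', y + y') \<in> T"
    and "\<And>a x y. (x, y) \<in> T \<Longrightarrow> (a *\<^sub>C x, a *\<^sub>C y) \<in> T"
    and "(0, 0) \<in> T" and "\<And>x y y'. (x, y) \<in> T \<Longrightarrow> (x, y') \<in> T \<Longrightarrow> y = y'"
  shows "linear_operator T"
  using assms unfolding linear_operator_def complex_vector.subspace_def single_valued_def
  by (auto simp: scaleC_prod_def zero_prod_def)

lemma in_resolvent_relation_iff:
  "(f, u) \<in> (z \<cdot>\<^sub>o Id \<ominus>\<^sub>o T)\<inverse> \<longleftrightarrow> (\<exists>w. (u, w) \<in> T \<and> f = z *\<^sub>C u - w)"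
  by (auto simp: op_diff_def op_scale_def)

lemma Re_pos_if_Arg: "\<bar>Arg z\<bar> < pi / 2 \<Longrightarrow> z \<noteq> 0 \<Longrightarrow> 0 < Re z"
  using cos_gt_zero_pi [of "Arg z"] by (simp add: cos_Arg zero_less_divide_iff abs_less_iff)

lemma abs_Arg_le_arctan_iff:
  assumes "0 < Re z"
  shows "\<bar>Arg z\<bar> \<le> arctan k \<longleftrightarrow> \<bar>Im z\<bar> \<le> k * \<bar>Re z\<bar>"
proof -
  have "\<bar>Arg z\<bar> \<le> arctan k \<longleftrightarrow> arctan (Im z / Re z) \<le> arctan k \<and> arctan (- (Im z / Re z)) \<le> arctan k"
    by (simp only: arg_conv_arctan [OF assms] abs_le_iff arctan_minus)
  also have "\<dots> \<longleftrightarrow> \<bar>Im z / Re z\<bar> \<le> k"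
    by (simp only: arctan_le_iff abs_le_iff)
  also have "\<dots> \<longleftrightarrow> \<bar>Im z\<bar> \<le> k * \<bar>Re z\<bar>"
    using assms by (simp add: abs_divide pos_divide_le_eq)
  finally show ?thesis .
qed

lemma bisector_arctan: "bisector (arctan k) = {z. \<bar>Im z\<bar> \<le> k * \<bar>Re z\<bar>}"
proof (intro set_eqI)
  fix z :: complex
  have lt: "arctan k < pi / 2" by (rule arctan_ubound)
  consider "z = 0" | "0 < Re z" | "0 < Re (- z)" | "z \<noteq> 0" "Re z = 0" by force
  then show "z \<in> bisector (arctan k) \<longleftrightarrow> z \<in> {z. \<bar>Im z\<bar> \<le> k * \<bar>Re z\<bar>}"
  proof cases
    case 2
    then show ?thesis
      using abs_Arg_le_arctan_iff [of z k] Re_pos_if_Arg [of "- z"] lt by (force simp: bisector_def)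
  next
    case 3
    then show ?thesis
      using abs_Arg_le_arctan_iff [of "- z" k] Re_pos_if_Arg [of z] lt by (force simp: bisector_def)
  next
    case 4
    then have "Im z \<noteq> 0" by (simp add: complex_eq_iff)
    with 4 show ?thesis
      using Re_pos_if_Arg [of z] Re_pos_if_Arg [of "- z"] lt by (force simp: bisector_def)
  qed (simp add: bisector_def)
qed

lemma imaginary_notin_bisector:
  assumes "\<omega> < pi / 2" "s \<noteq> 0"
  shows "\<i> * of_real s \<notin> bisector \<omega>"
  using assms Re_pos_if_Arg [of "\<i> * of_real s"] Re_pos_if_Arg [of "- (\<i> * of_real s)"]
  by (auto simp: bisector_def)

lemma bounded_inverse:
  assumes T: "linear_operator T"
    and onto: "\<And>f. \<exists>u w. (u, w) \<in> T \<and> z *\<^sub>C u - w = f"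
    and bd: "\<And>u w. (u, w) \<in> T \<Longrightarrow> norm u \<le> c * norm (z *\<^sub>C u - w)" and c: "0 \<le> c"
  shows "z \<in> resolvent_set T" "onorm (resolvent T z) \<le> c"
proof -
  obtain R S where RS: "\<And>f. (R f, S f) \<in> T" "\<And>f. z *\<^sub>C R f - S f = f"
    using onto by metis
  have R_eq: "R (z *\<^sub>C u - w) = u" if "(u, w) \<in> T" for u w
  proof -
    let ?f = "z *\<^sub>C u - w"
    have "norm (R ?f - u) \<le> c * norm (z *\<^sub>C (R ?f - u) - (S ?f - w))"
      by (intro bd linear_operator_diff T RS that)
    also have "z *\<^sub>C (R ?f - u) - (S ?f - w) = 0"
      using RS(2) [of ?f] by (simp add: complex_vector.scale_right_diff_distrib algebra_simps)
    finally show ?thesis by simp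
  qed
  have rel: "(z \<cdot>\<^sub>o Id \<ominus>\<^sub>o T)\<inverse> = op_of R"
  proof (intro set_eqI, clarify)
    fix f u
    have "(\<exists>w. (u, w) \<in> T \<and> f = z *\<^sub>C u - w) \<longleftrightarrow> u = R f"
      using RS [of f] R_eq [of u] by fastforce
    then show "(f, u) \<in> (z \<cdot>\<^sub>o Id \<ominus>\<^sub>o T)\<inverse> \<longleftrightarrow> (f, u) \<in> op_of R"
      by (simp only: in_resolvent_relation_iff op_of_def mem_Collect_eq) blast
  qed
  have add: "R (f + g) = R f + R g" for f g
    using R_eq [OF linear_operator_add [OF T RS(1) [of f] RS(1) [of g]]] RS(2) [of f] RS(2) [of g]
    by (simp add: scaleC_add_right add_diff_add)
  have scale: "R (a *\<^sub>C f) = a *\<^sub>C R f" for a f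
    using R_eq [OF linear_operator_scale [OF T RS(1) [of f], of a]] arg_cong [OF RS(2) [of f], of "scaleC a"]
    by (simp add: complex_vector.scale_right_diff_distrib scaleC_scaleC mult.commute)
  have norm_R: "norm (R f) \<le> c * norm f" for f
    using bd [OF RS(1) [of f]] by (simp add: RS(2))
  have "bounded_operator R"
    unfolding bounded_operator_def
    using add scale norm_R complex_vector.vector_space_axioms
    by (auto simp: Vector_Spaces.linear_iff)
  with rel show "z \<in> resolvent_set T"
    by (auto simp: resolvent_set_def)
  have "resolvent T z = R"
    by (rule ext) (simp add: resolvent_def rel op_app_def op_of_def)
  then show "onorm (resolvent T z) \<le> c"
    using onorm_bound [OF c norm_R] by simp
qed

text \<open>
  A bound by \<open>C / \<bar>z\<bar>\<close> suffices, because the double sector contains \<open>0\<close> and so its distance from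
  \<open>z\<close> is at most \<open>\<bar>z\<bar>\<close>.
\<close>

lemma bisectorialI:
  assumes T: "linear_operator T" and k: "0 \<le> k"
    and onto: "\<And>z f. k * \<bar>Re z\<bar> < \<bar>Im z\<bar> \<Longrightarrow> \<exists>u w. (u, w) \<in> T \<and> z *\<^sub>C u - w = f"
    and bd: "\<And>z u w. k * \<bar>Re z\<bar> < \<bar>Im z\<bar> \<Longrightarrow> (u, w) \<in> T \<Longrightarrow>
      cmod z * norm u \<le> C * norm (z *\<^sub>C u - w)" and C: "0 \<le> C"
  shows "bisectorial T"
proof -
  let ?S = "bisector (arctan k)"
  have cone: "k * \<bar>Re z\<bar> < \<bar>Im z\<bar>" if "z \<notin> ?S" for z
    using that by (simp add: bisector_arctan)
  have res: "z \<in> resolvent_set T" "onorm (resolvent T z) \<le> C / infdist z ?S" if z: "z \<notin> ?S" for z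
  proof -
    have nz: "z \<noteq> 0" using z by (auto simp: bisector_def)
    have le: "norm u \<le> C / cmod z * norm (z *\<^sub>C u - w)" if "(u, w) \<in> T" for u w
      using bd [OF cone [OF z] that] nz by (simp add: field_simps)
    have "0 \<le> C / cmod z" using C by simp
    note inv = bounded_inverse [OF T onto [OF cone [OF z]] le this]
    show "z \<in> resolvent_set T" by (rule inv)
    have "closed ?S" unfolding bisector_arctan
      by (intro closed_Collect_le continuous_intros)
    moreover have "0 \<in> ?S" by (simp add: bisector_def)
    \<comment> \<open>Positivity matters: at distance \<open>0\<close> the quotient by the distance would be \<open>0\<close>.\<close>
    ultimately have pos: "0 < infdist z ?S"
      using z by (metis in_closed_iff_infdist_zero infdist_nonneg less_eq_real_def empty_iff)
    have "infdist z ?S \<le> cmod z"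
      using infdist_le [OF \<open>0 \<in> ?S\<close>, of z] by simp
    then have "C / cmod z \<le> C / infdist z ?S"
      using pos C nz by (intro divide_left_mono mult_pos_pos) auto
    with inv(2) show "onorm (resolvent T z) \<le> C / infdist z ?S" by simp
  qed
  show ?thesis
    unfolding bisectorial_def spectrum_def
    using T res(1) k arctan_ubound [of k]
    by (intro conjI exI [of _ "arctan k"] exI [of _ C] allI impI res(2)) auto
qed

lemma bisectorial_resolvent_imaginary:
  assumes "bisectorial T" "s \<noteq> 0"
  shows "\<exists>u w. (u, w) \<in> T \<and> (\<i> * of_real s) *\<^sub>C u - w = f"
    and "(u, (\<i> * of_real s) *\<^sub>C u) \<in> T \<Longrightarrow> u = 0"
proof -
  from assms obtain R where R: "(((\<i> * of_real s) \<cdot>\<^sub>o Id \<ominus>\<^sub>o T)\<inverse>) = op_of R"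
    using imaginary_notin_bisector unfolding bisectorial_def spectrum_def resolvent_set_def by blast
  have iff: "(\<exists>w. (u, w) \<in> T \<and> f = (\<i> * of_real s) *\<^sub>C u - w) \<longleftrightarrow> u = R f" for u f
    using in_resolvent_relation_iff [of f u "\<i> * of_real s" T] by (auto simp: R op_of_def)
  show "\<exists>u w. (u, w) \<in> T \<and> (\<i> * of_real s) *\<^sub>C u - w = f"
    using iff [of "R f" f] by metis
  assume "(u, (\<i> * of_real s) *\<^sub>C u) \<in> T"
  then have "u = R 0" using iff [of u 0] by auto
  moreover have "(0, 0) \<in> T"
    using assms(1) linear_operator_zero by (auto simp: bisectorial_def)
  then have "0 = R 0" using iff [of 0 0] by auto
  ultimately show "u = 0" by simp
qed

text \<open>
  The operator \<open>1 + t\<^sup>2T\<^sup>2 = t\<^sup>2(T - z)(T + z)\<close>, where \<open>z = \<i> / t\<close>, is injective because both factors are;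
  so any \<open>u\<close> with \<open>(1 + t\<^sup>2T\<^sup>2)u = f\<close> computes the quadratic operator at \<open>f\<close>.
\<close>

lemma quadratic_op_eq:
  assumes T: "bisectorial T" and t: "0 < t" and uv: "(u, v) \<in> T" "(v, w) \<in> T"
  shows "quadratic_op T t (u + of_real (t\<^sup>2) *\<^sub>C w) = of_real t *\<^sub>C v"
proof -
  define f where "f = u + of_real (t\<^sup>2) *\<^sub>C w"
  define z where "z = \<i> * complex_of_real (1 / t)"
  have z2: "z * z * of_real (t\<^sup>2) = - 1"
    using t by (simp add: z_def field_simps power2_eq_square flip: of_real_mult)
  have lin: "linear_operator T" using T by (simp add: bisectorial_def)
  have in_rel: "(f, y) \<in> (of_real t \<cdot>\<^sub>o T) \<circ>\<^sub>o (Id \<oplus>\<^sub>o of_real (t\<^sup>2) \<cdot>\<^sub>o (T \<circ>\<^sub>o T))\<inverse> \<longleftrightarrow>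
      (\<exists>u v v' w. (u, v) \<in> T \<and> (v, w) \<in> T \<and> (u, v') \<in> T \<and> f = u + of_real (t\<^sup>2) *\<^sub>C w
         \<and> y = of_real t *\<^sub>C v')" for y
    by (fastforce simp: op_comp_def op_add_def op_scale_def)
  have uniq: "v' = v" if "(u', v') \<in> T" "(v', w') \<in> T" "f = u' + of_real (t\<^sup>2) *\<^sub>C w'" for u' v' w'
  proof -
    define a b c where "a = u' - u" and "b = v' - v" and "c = w' - w"
    have ab: "(a, b) \<in> T" and bc: "(b, c) \<in> T"
      unfolding a_def b_def c_def by (intro linear_operator_diff lin uv that)+
    have eq: "a + of_real (t\<^sup>2) *\<^sub>C c = 0"
      using that(3) by (simp add: f_def a_def c_def complex_vector.scale_right_diff_distrib
          algebra_simps)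
    have c: "c = (z * z) *\<^sub>C a"
    proof -
      have "(z * z) *\<^sub>C (a + of_real (t\<^sup>2) *\<^sub>C c) = (z * z) *\<^sub>C a + (z * z * of_real (t\<^sup>2)) *\<^sub>C c"
        by (simp only: scaleC_add_right scaleC_scaleC)
      then have "(z * z) *\<^sub>C a - c = 0"
        by (simp only: eq z2 complex_vector.scale_minus_left scaleC_one
            complex_vector.scale_zero_right) simp
      then show ?thesis by simp
    qed
    \<comment> \<open>The vector \<open>z a + T a\<close> is annihilated by \<open>z - T\<close>.\<close>
    have "(z *\<^sub>C a + b, z *\<^sub>C (z *\<^sub>C a + b)) \<in> T"
      using linear_operator_add [OF lin linear_operator_scale [OF lin ab, of z] bc]
      by (simp add: c scaleC_add_right scaleC_scaleC add.commute)
    then have "z *\<^sub>C a + b = 0"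
      using bisectorial_resolvent_imaginary(2) [OF T, of "1 / t"] t by (simp add: z_def)
    then have b: "b = (- z) *\<^sub>C a"
      by (simp add: complex_vector.scale_minus_left add_eq_0_iff)
    then have "a = 0"
      using bisectorial_resolvent_imaginary(2) [OF T, of "- (1 / t)" a] t ab by (simp add: z_def)
    with b show ?thesis by (simp add: b_def)
  qed
  have "(THE y. (f, y) \<in> (of_real t \<cdot>\<^sub>o T) \<circ>\<^sub>o (Id \<oplus>\<^sub>o of_real (t\<^sup>2) \<cdot>\<^sub>o (T \<circ>\<^sub>o T))\<inverse>)
      = of_real t *\<^sub>C v"
    unfolding in_rel
  proof (rule the_equality)
    show "\<exists>u v' v'' w. (u, v') \<in> T \<and> (v', w) \<in> T \<and> (u, v'') \<in> T \<and> f = u + of_real (t\<^sup>2) *\<^sub>C w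
         \<and> of_real t *\<^sub>C v = of_real t *\<^sub>C v''"
      using uv f_def by blast
  next
    fix y assume "\<exists>u v v' w. (u, v) \<in> T \<and> (v, w) \<in> T \<and> (u, v') \<in> T \<and>
         f = u + of_real (t\<^sup>2) *\<^sub>C w \<and> y = of_real t *\<^sub>C v'"
    then show "y = of_real t *\<^sub>C v"
      using uniq linear_operator_unique [OF lin] by metis
  qed
  then show ?thesis by (simp add: quadratic_op_def op_app_def f_def)
qed

text \<open>Surjectivity of \<open>1 + t\<^sup>2T\<^sup>2\<close>, from solving with the factors \<open>z - T\<close> and \<open>- z - T\<close> in turn.\<close>

lemma exists_square_resolvent:
  assumes T: "bisectorial T" and t: "0 < t"
  obtains u v w where "(u, v) \<in> T" "(v, w) \<in> T" "u + of_real (t\<^sup>2) *\<^sub>C w = f"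
proof -
  define z where "z = \<i> * complex_of_real (1 / t)"
  have z2: "z * z * of_real (t\<^sup>2) = - 1"
    using t by (simp add: z_def field_simps power2_eq_square flip: of_real_mult)
  have lin: "linear_operator T" using T by (simp add: bisectorial_def)
  obtain a a' where a: "(a, a') \<in> T" "z *\<^sub>C a - a' = (z * z) *\<^sub>C f"
    using bisectorial_resolvent_imaginary(1) [OF T, of "1 / t" "(z * z) *\<^sub>C f"] t
    by (auto simp: z_def)
  obtain b b' where b: "(b, b') \<in> T" "(- z) *\<^sub>C b - b' = a"
    using bisectorial_resolvent_imaginary(1) [OF T, of "- (1 / t)" a] t
    by (auto simp: z_def)
  have b': "b' = (- z) *\<^sub>C b - a" using b(2) by (simp add: algebra_simps)
  have c: "(b', (- z) *\<^sub>C b' - a') \<in> T"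
    using linear_operator_diff [OF lin linear_operator_scale [OF lin b(1), of "- z"] a(1)]
    by (simp add: b')
  have "(- z) *\<^sub>C b' - a' = (z * z) *\<^sub>C b + (z *\<^sub>C a - a')"
    by (simp add: b' complex_vector.scale_right_diff_distrib complex_vector.scale_minus_left
        scaleC_scaleC complex_vector.scale_minus_right)
  also have "\<dots> = (z * z) *\<^sub>C (b + f)"
    by (simp add: a(2) scaleC_add_right)
  finally have "- b + of_real (t\<^sup>2) *\<^sub>C (- ((- z) *\<^sub>C b' - a'))
      = - b + (- (z * z * of_real (t\<^sup>2))) *\<^sub>C (b + f)"
    by (simp add: complex_vector.scale_minus_right complex_vector.scale_minus_left scaleC_scaleC
        mult.commute)
  also have "\<dots> = f" by (simp only: z2) (simp add: scaleC_one)
  finally show thesis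
    using linear_operator_scale [OF lin b(1), of "- 1"] linear_operator_scale [OF lin c, of "- 1"]
    by (intro that [of "- b" "- b'" "- ((- z) *\<^sub>C b' - a')"])
      (simp_all add: complex_vector.scale_minus_left scaleC_one)
qed

section \<open>Accretive multiplicative perturbations of self-adjoint operators\<close>

lemma clinear_add: "Vector_Spaces.linear scaleC scaleC B \<Longrightarrow> B (x + y) = B x + B y"
  and clinear_scale: "Vector_Spaces.linear scaleC scaleC B \<Longrightarrow> B (a *\<^sub>C x) = a *\<^sub>C B x"
  by (simp_all add: Vector_Spaces.linear_iff)

lemma clinear_diff:
  assumes "Vector_Spaces.linear scaleC scaleC B"
  shows "B (x - y) = B x - B y"
  using clinear_add [OF assms, of "x - y" y] by simp

lemma clinear_zero: "Vector_Spaces.linear scaleC scaleC B \<Longrightarrow> B 0 = 0"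
  using clinear_diff [of B 0 0] by simp

text \<open>
  Here \<open>w\<close> stands for \<open>Du\<close> and \<open>b\<close> for \<open>BDu\<close>.  In \<open>z (u, w) = (b, w) + (f, w)\<close> with \<open>(u, w)\<close> real,
  the imaginary part bounds \<open>\<bar>Im z (u, w)\<bar>\<close> by \<open>M \<parallel>w\<parallel>\<^sup>2 + \<parallel>f\<parallel> \<parallel>w\<parallel>\<close>.  For
  \<open>\<bar>Im z\<bar> \<ge> k \<bar>Re z\<bar>\<close> with \<open>k = 2M / \<delta>\<close> this controls the real part of the left side by \<open>\<delta> / 2 \<parallel>w\<parallel>\<^sup>2\<close> plus a multiple of
  \<open>\<parallel>f\<parallel> \<parallel>w\<parallel>\<close>, and half of the accretivity of \<open>b\<close> survives.
\<close>

lemma accretive_estimate: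
  fixes u w b :: "'h::complex_inner"
  assumes sym: "Im (cinner u w) = 0"
    and acc: "\<delta> * (norm w)\<^sup>2 \<le> Re (cinner b w)" and bd: "norm b \<le> M * norm w"
    and pos: "0 < \<delta>" "0 < M"
    and cone: "2 * M / \<delta> * \<bar>Re z\<bar> \<le> \<bar>Im z\<bar>"
  shows "M * norm w \<le> (1 + 2 * M / \<delta>) * norm (z *\<^sub>C u - b)"
    and "cmod z * norm u \<le> (2 + 2 * M / \<delta>) * norm (z *\<^sub>C u - b)"
proof -
  define f where "f = z *\<^sub>C u - b"
  define k where "k = 2 * M / \<delta>"
  define q where "q = Re (cinner u w)"
  have k: "0 < k" "k * \<delta> = 2 * M" using pos by (auto simp: k_def)
  have u_w: "cinner u w = of_real q" using sym by (simp add: q_def complex_eq_iff)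
  have eq: "cinner f w = z * of_real q - cinner b w"
    by (simp add: f_def cinner_diff_left cinner_scaleC_left u_w)
  have g: "cmod (cinner f w) \<le> norm f * norm w" by (rule norm_cinner_le)
  have p: "cmod (cinner b w) \<le> M * (norm w)\<^sup>2"
    using order_trans [OF norm_cinner_le mult_right_mono [OF bd, of "norm w"]]
    by (simp add: power2_eq_square mult.assoc)
  have re: "Re (cinner b w) = Re z * q - Re (cinner f w)"
    and im: "Im z * q = Im (cinner b w) + Im (cinner f w)"
    using eq by (simp_all add: complex_eq_iff)
  have "k * \<bar>Re z * q\<bar> \<le> \<bar>Im z * q\<bar>"
    using mult_right_mono [OF cone, of "\<bar>q\<bar>"] by (simp add: k_def abs_mult mult.assoc)
  also have "\<dots> \<le> M * (norm w)\<^sup>2 + norm f * norm w"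
    unfolding im using abs_Im_le_cmod [of "cinner b w"] abs_Im_le_cmod [of "cinner f w"] g p
    by linarith
  finally have 1: "k * \<bar>Re z * q\<bar> \<le> M * (norm w)\<^sup>2 + norm f * norm w" .
  have "Re (cinner b w) \<le> \<bar>Re z * q\<bar> + norm f * norm w"
    unfolding re using abs_Re_le_cmod [of "cinner f w"] g by linarith
  then have "k * (\<delta> * (norm w)\<^sup>2) \<le> k * (\<bar>Re z * q\<bar> + norm f * norm w)"
    using acc k(1) by (intro mult_left_mono) auto
  also have "\<dots> \<le> M * (norm w)\<^sup>2 + (1 + k) * (norm f * norm w)"
    using 1 by (simp add: algebra_simps)
  also have "k * (\<delta> * (norm w)\<^sup>2) = 2 * M * (norm w)\<^sup>2"
    by (simp add: k(2) flip: mult.assoc)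
  finally have "(M * norm w) * norm w \<le> ((1 + k) * norm f) * norm w"
    by (simp add: power2_eq_square mult.assoc)
  then show w: "M * norm w \<le> (1 + 2 * M / \<delta>) * norm (z *\<^sub>C u - b)"
    using k(1) by (cases "w = 0") (auto simp: f_def k_def)
  have "cmod z * norm u = norm (f + b)"
    by (simp add: f_def norm_scaleC)
  also have "\<dots> \<le> norm f + norm b" by (rule norm_triangle_ineq)
  also have "\<dots> \<le> (2 + 2 * M / \<delta>) * norm (z *\<^sub>C u - b)"
    using w bd by (simp add: f_def algebra_simps)
  finally show "cmod z * norm u \<le> (2 + 2 * M / \<delta>) * norm (z *\<^sub>C u - b)" .
qed

text \<open>
  The assumptions on \<open>D\<close> say that it is self-adjoint, in the form of symmetry and surjectivity of
  \<open>\<plusminus>\<i> - D\<close>.  The normalisation \<open>\<delta> \<le> 1 \<le> M\<close> lets all convex combinations of \<open>I\<close> and \<open>B\<close> share the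
  constants of \<open>B\<close>, and the half cone containing \<open>z\<close> is convex, so that \<open>accretive_estimate\<close> is
  available uniformly along the segment to be traversed.
\<close>

lemma accretive_perturbation_onto:
  fixes D :: "'h::complex_hilbert rel"
  assumes D: "linear_operator D"
    and sym: "\<And>u w. (u, w) \<in> D \<Longrightarrow> Im (cinner u w) = 0"
    and onto: "\<And>e f. e = \<i> \<or> e = - \<i> \<Longrightarrow> \<exists>u w. (u, w) \<in> D \<and> e *\<^sub>C u - w = f"
    and B: "Vector_Spaces.linear scaleC scaleC B"
    and acc: "\<And>u w. (u, w) \<in> D \<Longrightarrow> \<delta> * (norm w)\<^sup>2 \<le> Re (cinner (B w) w)"
    and bd: "\<And>w. norm (B w) \<le> M * norm w"
    and \<delta>: "0 < \<delta>" "\<delta> \<le> 1" and M: "1 \<le> M"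
    and cone: "2 * M / \<delta> * \<bar>Re z\<bar> < \<bar>Im z\<bar>"
  shows "\<exists>u w. (u, w) \<in> D \<and> z *\<^sub>C u - B w = f"
proof -
  define k where "k = 2 * M / \<delta>"
  have k: "0 < k" using \<delta> M by (simp add: k_def)
  have im: "Im z \<noteq> 0"
    using cone k by (auto simp: k_def [symmetric] mult_less_0_iff)
  \<comment> \<open>The path of spectral parameters starts in the half of the double cone that contains \<open>z\<close>.\<close>
  define e where "e = (if 0 < Im z then \<i> else - \<i>)"
  define m where "m = min 1 \<bar>Im z\<bar>"
  have m: "0 < m" using im by (simp add: m_def)
  define L\<^sub>0 L\<^sub>1 :: "'h \<times> 'h \<Rightarrow> 'h" where "L\<^sub>0 = (\<lambda>(u, w). e *\<^sub>C u - w)" and "L\<^sub>1 = (\<lambda>(u, w). z *\<^sub>C u - B w)"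
  define K where "K = cmod (z - e) * ((2 + k) / m) + (M + 1) * (1 + k)"
  have "L\<^sub>1 ` D = UNIV"
  proof (rule method_of_continuity [of L\<^sub>0 L\<^sub>1])
    show "linear L\<^sub>0"
      by (rule linearI) (auto simp: L\<^sub>0_def scaleC_prod_def scaleC_add_right scaleR_eq_scaleC scaleC_scaleC
          complex_vector.scale_right_diff_distrib mult.commute)
    show "linear L\<^sub>1"
      by (rule linearI) (auto simp: L\<^sub>1_def scaleC_prod_def scaleC_add_right scaleR_eq_scaleC scaleC_scaleC
          complex_vector.scale_right_diff_distrib mult.commute clinear_add [OF B]
          clinear_scale [OF B])
    show "subspace D"
      using D by (simp add: linear_operator_def subspace_if_complex_subspace)
    show "L\<^sub>0 ` D = UNIV"
    proof -
      have "f \<in> L\<^sub>0 ` D" for f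
        using onto [of e f] by (force simp: e_def L\<^sub>0_def)
      then show ?thesis by blast
    qed
  next
    fix s :: real and v assume s: "0 \<le> s" "s \<le> 1" and v: "v \<in> D"
    obtain u w where uw: "v = (u, w)" "(u, w) \<in> D" using v by (cases v) auto
    define \<mu> where "\<mu> = of_real (1 - s) * e + of_real s * z"
    define b where "b = (1 - s) *\<^sub>R w + s *\<^sub>R B w"
    have comb: "(1 - s) *\<^sub>R L\<^sub>0 v + s *\<^sub>R L\<^sub>1 v = \<mu> *\<^sub>C u - b"
      by (simp add: uw L\<^sub>0_def L\<^sub>1_def \<mu>_def b_def scaleR_eq_scaleC scaleC_add_left
          complex_vector.scale_right_diff_distrib scaleC_scaleC)
    have Im_\<mu>: "\<bar>Im \<mu>\<bar> = (1 - s) + s * \<bar>Im z\<bar>"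
    proof (cases "0 < Im z")
      case True
      then show ?thesis using s by (simp add: \<mu>_def e_def)
    next
      case False
      then have "Im \<mu> = - ((1 - s) + s * \<bar>Im z\<bar>)" by (simp add: \<mu>_def e_def)
      moreover have "0 \<le> s * \<bar>Im z\<bar>" using s by simp
      ultimately show ?thesis using s by linarith
    qed
    have Re_\<mu>: "\<bar>Re \<mu>\<bar> = s * \<bar>Re z\<bar>"
      using s by (simp add: \<mu>_def e_def abs_mult)
    have "s * (k * \<bar>Re z\<bar>) \<le> s * \<bar>Im z\<bar>"
      using cone s by (intro mult_left_mono) (auto simp: k_def)
    then have cone_\<mu>: "2 * M / \<delta> * \<bar>Re \<mu>\<bar> \<le> \<bar>Im \<mu>\<bar>"
      using s unfolding Im_\<mu> Re_\<mu> k_def [symmetric] by (simp add: mult.left_commute)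
    have "(1 - s) * m + s * m \<le> \<bar>Im \<mu>\<bar>"
      unfolding Im_\<mu> using s by (intro add_mono mult_left_mono) (auto simp: m_def mult_left_le)
    then have m_le: "m \<le> cmod \<mu>"
      using abs_Im_le_cmod [of \<mu>] by (simp add: algebra_simps)
    have re_b: "Re (cinner b w) = (1 - s) * (norm w)\<^sup>2 + s * Re (cinner (B w) w)"
      by (simp add: b_def Re_cinner inner_add_left power2_norm_eq_inner)
    have "(1 - s) * (\<delta> * (norm w)\<^sup>2) + s * (\<delta> * (norm w)\<^sup>2) \<le> Re (cinner b w)"
      unfolding re_b using s \<delta> acc [OF uw(2)]
      by (intro add_mono mult_left_mono) (auto simp: mult_left_le_one_le)
    then have acc_b: "\<delta> * (norm w)\<^sup>2 \<le> Re (cinner b w)"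
      by (simp add: algebra_simps)
    have "norm b \<le> (1 - s) * norm w + s * norm (B w)"
      unfolding b_def using s by (intro norm_triangle_le) auto
    also have "\<dots> \<le> (1 - s) * (M * norm w) + s * (M * norm w)"
      using s M bd [of w] by (intro add_mono mult_left_mono) (auto simp: mult_le_cancel_right1)
    finally have bd_b: "norm b \<le> M * norm w"
      by (simp add: algebra_simps)
    note est = accretive_estimate [OF sym [OF uw(2)] acc_b bd_b \<delta>(1) _ cone_\<mu>, folded k_def]
    let ?N = "norm (\<mu> *\<^sub>C u - b)"
    have "m * norm u \<le> (2 + k) * ?N"
      using est(2) M mult_right_mono [OF m_le, of "norm u"] by simp
    then have u: "norm u \<le> (2 + k) / m * ?N"
      using m by (simp add: field_simps)
    have w: "norm w \<le> (1 + k) * ?N"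
      using est(1) M mult_right_mono [OF M, of "norm w"] by simp
    have "norm (L\<^sub>1 v - L\<^sub>0 v) = norm ((z - e) *\<^sub>C u + (w - B w))"
      by (simp add: uw L\<^sub>0_def L\<^sub>1_def complex_vector.scale_left_diff_distrib algebra_simps)
    also have "\<dots> \<le> cmod (z - e) * norm u + (norm w + M * norm w)"
      using bd [of w] norm_triangle_ineq4 [of w "B w"]
      by (intro norm_triangle_le) (simp add: norm_scaleC)
    also have "\<dots> = cmod (z - e) * norm u + (M + 1) * norm w"
      by (simp add: algebra_simps)
    also have "\<dots> \<le> cmod (z - e) * ((2 + k) / m * ?N) + (M + 1) * ((1 + k) * ?N)"
      using M by (intro add_mono mult_left_mono u w) auto
    also have "\<dots> = K * ?N"
      by (simp add: K_def algebra_simps)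
    finally show "norm (L\<^sub>1 v - L\<^sub>0 v) \<le> K * norm ((1 - s) *\<^sub>R L\<^sub>0 v + s *\<^sub>R L\<^sub>1 v)"
      by (simp only: comb)
  qed
  then have "f \<in> L\<^sub>1 ` D" by simp
  then show ?thesis by (auto simp: L\<^sub>1_def)
qed

section \<open>The operator matrix and the perturbed Dirac operator\<close>

lemma op_adjoint_iff:
  "(y, z) \<in> op_adjoint T \<longleftrightarrow> (\<forall>x w. (x, w) \<in> T \<longrightarrow> cinner w y = cinner x z)"
  by (auto simp: op_adjoint_def)

lemma linear_operator_adjoint:
  fixes T :: "'a::complex_inner rel"
  assumes "closure (Domain T) = UNIV"
  shows "linear_operator (op_adjoint T)"
proof (rule linear_operatorI)
  fix y z z' assume *: "(y, z) \<in> op_adjoint T" "(y, z') \<in> op_adjoint T"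
  have "Domain T \<subseteq> {x. inner x (z - z') = 0}"
  proof (clarify)
    fix x w assume "(x, w) \<in> T"
    then have "cinner x z = cinner x z'"
      using * by (metis op_adjoint_iff)
    then have "inner x z = inner x z'"
      by (metis Re_cinner)
    then show "inner x (z - z') = 0"
      by (simp add: inner_diff_right)
  qed
  moreover have "closed {x. inner x (z - z') = 0}"
    by (intro closed_Collect_eq continuous_intros)
  ultimately have "closure (Domain T) \<subseteq> {x. inner x (z - z') = 0}"
    by (rule closure_minimal)
  then have "inner (z - z') (z - z') = 0" unfolding assms by blast
  then show "z = z'" by simp
qed (simp_all add: op_adjoint_iff cinner_add_right cinner_scaleC_right cinner_zero_right)

lemma off_diagonal_iff:
  "((x, y), (b, c)) \<in> op_block (zero_on UNIV) S T (zero_on UNIV) \<longleftrightarrow>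
     (y, b) \<in> S \<and> (x, c) \<in> (T :: 'a::monoid_add rel)"
  by (auto simp: op_block_def zero_on_def)

lemma op_block_diagonal:
  "op_block (op_of B\<^sub>1) (zero_on UNIV) (zero_on UNIV) (op_of B\<^sub>2)
     = op_of (map_prod B\<^sub>1 (B\<^sub>2 :: 'a::monoid_add \<Rightarrow> 'a))"
  by (auto simp: op_block_def zero_on_def op_of_def)

lemma op_of_comp_iff: "(x, z) \<in> op_of B \<circ>\<^sub>o T \<longleftrightarrow> (\<exists>y. (x, y) \<in> T \<and> z = B y)"
  by (auto simp: op_comp_def op_of_def)

text \<open>
  The operator identities are recorded for points of the graphs, as statements about null spaces, and
  the constants are common to both multipliers and normalised for \<open>accretive_perturbation_onto\<close>.
\<close>

locale perturbed_dirac =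
  fixes \<Gamma> :: "'a::complex_hilbert rel" and B\<^sub>1 B\<^sub>2 :: "'a \<Rightarrow> 'a" and \<delta> M :: real
  assumes \<Gamma>: "closed_densely_defined \<Gamma>"
    and linear_B: "Vector_Spaces.linear scaleC scaleC B\<^sub>1" "Vector_Spaces.linear scaleC scaleC B\<^sub>2"
    and norm_B: "\<And>x. norm (B\<^sub>1 x) \<le> M * norm x" "\<And>x. norm (B\<^sub>2 x) \<le> M * norm x"
    and accretive_B\<^sub>1: "\<And>y b. (y, b) \<in> op_adjoint \<Gamma> \<Longrightarrow> \<delta> * (norm b)\<^sup>2 \<le> Re (cinner (B\<^sub>1 b) b)"
    and accretive_B\<^sub>2: "\<And>x c. (x, c) \<in> \<Gamma> \<Longrightarrow> \<delta> * (norm c)\<^sup>2 \<le> Re (cinner (B\<^sub>2 c) c)"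
    and \<delta>: "0 < \<delta>" "\<delta> \<le> 1" and M: "1 \<le> M"
    and nilpotent: "\<And>x c. (x, c) \<in> \<Gamma> \<Longrightarrow> (c, 0) \<in> \<Gamma>"
    and B\<^sub>2B\<^sub>1_into_null: "\<And>y b. (y, b) \<in> op_adjoint \<Gamma> \<Longrightarrow> (B\<^sub>2 (B\<^sub>1 b), 0) \<in> op_adjoint \<Gamma>"
begin

abbreviation "\<Gamma>' \<equiv> op_adjoint \<Gamma>"
abbreviation "\<Pi>\<^sub>B \<equiv> \<Gamma> \<oplus>\<^sub>o op_of B\<^sub>1 \<circ>\<^sub>o \<Gamma>' \<circ>\<^sub>o op_of B\<^sub>2"
abbreviation "D \<equiv> op_block (zero_on UNIV) \<Gamma>' \<Gamma> (zero_on UNIV)"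
abbreviation "BD \<equiv> op_of (map_prod B\<^sub>1 B\<^sub>2) \<circ>\<^sub>o D"

definition "k = 2 * M / \<delta>"

lemma k_pos: "0 < k"
  using \<delta> M by (simp add: k_def)

lemma linear_\<Gamma>: "linear_operator \<Gamma>" and linear_\<Gamma>': "linear_operator \<Gamma>'"
  using \<Gamma> linear_operator_adjoint by (auto simp: closed_densely_defined_def)

lemma adjointD: "(x, c) \<in> \<Gamma> \<Longrightarrow> (y, b) \<in> \<Gamma>' \<Longrightarrow> cinner c y = cinner x b"
  by (auto simp: op_adjoint_def)

lemma \<Pi>\<^sub>B_iff: "(u, v) \<in> \<Pi>\<^sub>B \<longleftrightarrow> (\<exists>c b. (u, c) \<in> \<Gamma> \<and> (B\<^sub>2 u, b) \<in> \<Gamma>' \<and> v = c + B\<^sub>1 b)"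
  by (fastforce simp: op_add_def op_comp_def op_of_def)

lemma BD_iff: "((x, y), (p, q)) \<in> BD \<longleftrightarrow> (\<exists>b c. (y, b) \<in> \<Gamma>' \<and> (x, c) \<in> \<Gamma> \<and> p = B\<^sub>1 b \<and> q = B\<^sub>2 c)"
  unfolding op_of_comp_iff by (auto simp: off_diagonal_iff)

lemma linear_\<Pi>\<^sub>B: "linear_operator \<Pi>\<^sub>B"
proof (rule linear_operatorI)
  fix x y x' y' assume "(x, y) \<in> \<Pi>\<^sub>B" "(x', y') \<in> \<Pi>\<^sub>B"
  then obtain c b c' b' where *: "(x, c) \<in> \<Gamma>" "(B\<^sub>2 x, b) \<in> \<Gamma>'" "y = c + B\<^sub>1 b"
    "(x', c') \<in> \<Gamma>" "(B\<^sub>2 x', b') \<in> \<Gamma>'" "y' = c' + B\<^sub>1 b'"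
    unfolding \<Pi>\<^sub>B_iff by blast
  show "(x + x', y + y') \<in> \<Pi>\<^sub>B"
    unfolding \<Pi>\<^sub>B_iff
    using linear_operator_add [OF linear_\<Gamma> *(1,4)] linear_operator_add [OF linear_\<Gamma>' *(2,5)]
    by (intro exI [of _ "c + c'"] exI [of _ "b + b'"]) (simp add: * clinear_add linear_B)
next
  fix a x y assume "(x, y) \<in> \<Pi>\<^sub>B"
  then obtain c b where *: "(x, c) \<in> \<Gamma>" "(B\<^sub>2 x, b) \<in> \<Gamma>'" "y = c + B\<^sub>1 b"
    unfolding \<Pi>\<^sub>B_iff by blast
  show "(a *\<^sub>C x, a *\<^sub>C y) \<in> \<Pi>\<^sub>B"
    unfolding \<Pi>\<^sub>B_iff
    using linear_operator_scale [OF linear_\<Gamma> *(1)] linear_operator_scale [OF linear_\<Gamma>' *(2)]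
    by (intro exI [of _ "a *\<^sub>C c"] exI [of _ "a *\<^sub>C b"])
      (simp add: * clinear_scale linear_B scaleC_add_right)
next
  show "(0, 0) \<in> \<Pi>\<^sub>B"
    unfolding \<Pi>\<^sub>B_iff
    by (intro exI [of _ 0])
      (simp add: clinear_zero linear_B linear_operator_zero linear_\<Gamma> linear_\<Gamma>')
next
  fix x y y' assume "(x, y) \<in> \<Pi>\<^sub>B" "(x, y') \<in> \<Pi>\<^sub>B"
  then show "y = y'"
    unfolding \<Pi>\<^sub>B_iff
    using linear_operator_unique [OF linear_\<Gamma>] linear_operator_unique [OF linear_\<Gamma>'] by metis
qed

lemma linear_D: "linear_operator D"
proof (rule linear_operatorI)
  fix x y x' y' :: "'a \<times> 'a"
  assume "(x, y) \<in> D" "(x', y') \<in> D"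
  then show "(x + x', y + y') \<in> D"
    by (cases x; cases y; cases x'; cases y')
      (simp add: off_diagonal_iff linear_operator_add linear_\<Gamma> linear_\<Gamma>')
next
  fix a and x y :: "'a \<times> 'a" assume "(x, y) \<in> D"
  then show "(a *\<^sub>C x, a *\<^sub>C y) \<in> D"
    by (cases x; cases y)
      (simp add: off_diagonal_iff linear_operator_scale linear_\<Gamma> linear_\<Gamma>' scaleC_prod_def)
next
  show "(0, 0) \<in> D"
    by (simp add: zero_prod_def off_diagonal_iff linear_operator_zero linear_\<Gamma> linear_\<Gamma>')
next
  fix x y y' :: "'a \<times> 'a" assume "(x, y) \<in> D" "(x, y') \<in> D"
  then show "y = y'"
    using linear_operator_unique [OF linear_\<Gamma>] linear_operator_unique [OF linear_\<Gamma>']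
    by (cases x; cases y; cases y') (auto simp: off_diagonal_iff)
qed

lemma symmetric_D:
  assumes "(u, w) \<in> D"
  shows "Im (cinner u w) = 0"
proof -
  obtain x y b c where *: "u = (x, y)" "w = (b, c)" "(y, b) \<in> \<Gamma>'" "(x, c) \<in> \<Gamma>"
    using assms by (cases u; cases w) (auto simp: off_diagonal_iff)
  have "cinner u w = cinner x b + cinner y c" by (simp add: * cinner_prod_def)
  also have "cinner y c = cnj (cinner x b)"
    using adjointD [OF *(4,3)] cinner_commute by metis
  finally show ?thesis by simp
qed

text \<open>
  Solving \<open>(e - D)(x, y) = (f, g)\<close> amounts to \<open>e x - \<Gamma>\<^sup>*y = f\<close> and \<open>\<Gamma>(e x) + y = - e g\<close>, that is, to
  splitting \<open>(f, - e g)\<close> into the point of the graph of \<open>\<Gamma>\<close> above \<open>e x\<close> and a remainder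
  \<open>(- \<Gamma>\<^sup>*y, y)\<close> orthogonal to that graph.
\<close>

lemma D_onto:
  assumes e: "e = \<i> \<or> e = - \<i>"
  shows "\<exists>u w. (u, w) \<in> D \<and> e *\<^sub>C u - w = F"
proof -
  obtain f g where F: "F = (f, g)" by (cases F)
  have e2: "e * e = - 1" using e by auto
  have "complex_vector.subspace \<Gamma>" "closed \<Gamma>"
    using \<Gamma> by (auto simp: closed_densely_defined_def linear_operator_def)
  then obtain p where "p \<in> \<Gamma>"
    and p_orth: "\<And>v. v \<in> \<Gamma> \<Longrightarrow> cinner ((f, - e *\<^sub>C g) - p) v = 0"
    using exists_orthogonal_projection [of \<Gamma>] by metis
  then obtain p\<^sub>1 p\<^sub>2 where p: "p = (p\<^sub>1, p\<^sub>2)" "(p\<^sub>1, p\<^sub>2) \<in> \<Gamma>" by (cases p) auto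
  define r s where "r = f - p\<^sub>1" and "s = - e *\<^sub>C g - p\<^sub>2"
  \<comment> \<open>The orthogonal complement of the graph of \<open>\<Gamma>\<close> is the rotated graph of \<open>\<Gamma>\<^sup>*\<close>.\<close>
  have "(s, - r) \<in> \<Gamma>'"
    unfolding op_adjoint_def
  proof (clarify)
    fix x w assume "(x, w) \<in> \<Gamma>"
    from p_orth [OF this] have "cinner r x + cinner s w = 0"
      by (simp add: p r_def s_def cinner_prod_def)
    then have "cnj (cinner r x) + cnj (cinner s w) = 0"
      by (metis complex_cnj_add complex_cnj_zero)
    then show "cinner w s = cinner x (- r)"
      by (simp add: cinner_minus_right cinner_commute [of w s] cinner_commute [of x r]
          eq_neg_iff_add_eq_0 add.commute)
  qed
  moreover have "(- e *\<^sub>C p\<^sub>1, - e *\<^sub>C p\<^sub>2) \<in> \<Gamma>"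
    by (intro linear_operator_scale linear_\<Gamma> p)
  ultimately have "((- e *\<^sub>C p\<^sub>1, s), (- r, - e *\<^sub>C p\<^sub>2)) \<in> D"
    by (simp add: off_diagonal_iff)
  moreover have "e *\<^sub>C (- e *\<^sub>C p\<^sub>1, s) - (- r, - e *\<^sub>C p\<^sub>2) = F"
    by (simp add: F r_def s_def scaleC_prod_def scaleC_scaleC e2 scaleC_one
        complex_vector.scale_minus_left complex_vector.scale_right_diff_distrib
        complex_vector.scale_minus_right)
  ultimately show ?thesis by blast
qed

lemma linear_block: "Vector_Spaces.linear scaleC scaleC (map_prod B\<^sub>1 B\<^sub>2)"
  using linear_B complex_vector.vector_space_axioms
  by (auto simp: Vector_Spaces.linear_iff scaleC_prod_def)

lemma norm_block: "norm (map_prod B\<^sub>1 B\<^sub>2 w) \<le> M * norm w"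
proof -
  have "(norm (map_prod B\<^sub>1 B\<^sub>2 w))\<^sup>2 = (norm (B\<^sub>1 (fst w)))\<^sup>2 + (norm (B\<^sub>2 (snd w)))\<^sup>2"
    by (simp add: norm_prod_def)
  also have "\<dots> \<le> (M * norm (fst w))\<^sup>2 + (M * norm (snd w))\<^sup>2"
    by (intro add_mono power_mono norm_B) auto
  also have "\<dots> = (M * norm w)\<^sup>2"
    by (simp add: norm_prod_def power_mult_distrib algebra_simps)
  finally show ?thesis
    using M by (simp add: power2_le_iff_abs_le)
qed

lemma accretive_block:
  assumes "(u, w) \<in> D"
  shows "\<delta> * (norm w)\<^sup>2 \<le> Re (cinner (map_prod B\<^sub>1 B\<^sub>2 w) w)"
proof -
  obtain x y b c where *: "w = (b, c)" "(y, b) \<in> \<Gamma>'" "(x, c) \<in> \<Gamma>"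
    using assms by (cases u; cases w) (auto simp: off_diagonal_iff)
  show ?thesis
    using accretive_B\<^sub>1 [OF *(2)] accretive_B\<^sub>2 [OF *(3)]
    by (simp add: * cinner_prod_def norm_prod_def algebra_simps)
qed

lemma norm_graph_le: "norm (f, B\<^sub>2 f) \<le> (1 + M) * norm f"
  using norm_Pair_le [of f "B\<^sub>2 f"] norm_B(2) [of f] by (simp add: algebra_simps)

text \<open>
  The solution is \<open>u = x + z\<^sup>-\<^sup>1\<Gamma>x\<close>, where \<open>(x, y)\<close> solves \<open>(z - BD)(x, y) = (f, B\<^sub>2 f)\<close>.
\<close>

lemma \<Pi>\<^sub>B_onto:
  assumes cone: "k * \<bar>Re z\<bar> < \<bar>Im z\<bar>"
  shows "\<exists>u v. (u, v) \<in> \<Pi>\<^sub>B \<and> z *\<^sub>C u - v = f"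
proof -
  have nz: "z \<noteq> 0" using cone by auto
  have "\<exists>p w. (p, w) \<in> D \<and> z *\<^sub>C p - map_prod B\<^sub>1 B\<^sub>2 w = (f, B\<^sub>2 f)"
    by (rule accretive_perturbation_onto [OF linear_D symmetric_D D_onto linear_block
          accretive_block norm_block \<delta> M cone [unfolded k_def]])
  then obtain p w where "(p, w) \<in> D" "z *\<^sub>C p - map_prod B\<^sub>1 B\<^sub>2 w = (f, B\<^sub>2 f)"
    by blast
  then obtain x y b c where *: "(y, b) \<in> \<Gamma>'" "(x, c) \<in> \<Gamma>"
    "z *\<^sub>C x - B\<^sub>1 b = f" "z *\<^sub>C y - B\<^sub>2 c = B\<^sub>2 f"
    by (cases p; cases w) (auto simp: off_diagonal_iff scaleC_prod_def)
  define i where "i = inverse z"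
  have i: "i * z = 1" "z * i = 1" using nz by (auto simp: i_def)
  define u where "u = x + i *\<^sub>C c"
  have "x = i *\<^sub>C (z *\<^sub>C x)" "y = i *\<^sub>C (z *\<^sub>C y)"
    by (simp_all add: scaleC_scaleC i scaleC_one)
  moreover have "z *\<^sub>C x = f + B\<^sub>1 b" "z *\<^sub>C y = B\<^sub>2 (f + c)"
    using *(3,4) by (simp_all add: diff_eq_eq clinear_add linear_B)
  ultimately have x: "x = i *\<^sub>C (f + B\<^sub>1 b)" and y: "y = i *\<^sub>C B\<^sub>2 (f + c)" by simp_all
  have "(u, c) \<in> \<Gamma>"
    using linear_operator_add [OF linear_\<Gamma> *(2) linear_operator_scale [OF linear_\<Gamma> nilpotent [OF *(2)], of i]]
    by (simp add: u_def)
  moreover have "B\<^sub>2 u = y + i *\<^sub>C B\<^sub>2 (B\<^sub>1 b)"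
    by (simp add: u_def x y clinear_add clinear_scale linear_B scaleC_add_right)
  then have "(B\<^sub>2 u, b) \<in> \<Gamma>'"
    using linear_operator_add [OF linear_\<Gamma>' *(1)
        linear_operator_scale [OF linear_\<Gamma>' B\<^sub>2B\<^sub>1_into_null [OF *(1)], of i]]
    by simp
  ultimately have "(u, c + B\<^sub>1 b) \<in> \<Pi>\<^sub>B" unfolding \<Pi>\<^sub>B_iff by blast
  moreover have "z *\<^sub>C u - (c + B\<^sub>1 b) = f"
    using *(3) by (simp add: u_def scaleC_add_right scaleC_scaleC i scaleC_one algebra_simps)
  ultimately show ?thesis by blast
qed

text \<open>
  Inverts the substitution of \<open>\<Pi>\<^sub>B_onto\<close>: \<open>x = u - z\<^sup>-\<^sup>1\<Gamma>u\<close> and \<open>y = B\<^sub>2(u - z\<^sup>-\<^sup>1B\<^sub>1\<Gamma>\<^sup>*B\<^sub>2u)\<close> satisfy the equation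
  for \<open>BD\<close> with right-hand side \<open>(f, B\<^sub>2 f)\<close>, and the estimates for \<open>BD\<close> bound both terms of
  \<open>z u = z x + \<Gamma>x\<close>.
\<close>

lemma \<Pi>\<^sub>B_estimate:
  assumes cone: "k * \<bar>Re z\<bar> < \<bar>Im z\<bar>" and uv: "(u, v) \<in> \<Pi>\<^sub>B"
  shows "cmod z * norm u \<le> (3 + 2 * k) * (1 + M) * norm (z *\<^sub>C u - v)"
proof -
  have nz: "z \<noteq> 0" using cone by auto
  define i where "i = inverse z"
  have i: "i * z = 1" "z * i = 1" using nz by (auto simp: i_def)
  define f where "f = z *\<^sub>C u - v"
  obtain c b where *: "(u, c) \<in> \<Gamma>" "(B\<^sub>2 u, b) \<in> \<Gamma>'" "v = c + B\<^sub>1 b"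
    using uv unfolding \<Pi>\<^sub>B_iff by blast
  define x where "x = u - i *\<^sub>C c"
  define y where "y = B\<^sub>2 u - i *\<^sub>C B\<^sub>2 (B\<^sub>1 b)"
  have "(x, c) \<in> \<Gamma>"
    using linear_operator_diff [OF linear_\<Gamma> *(1) linear_operator_scale [OF linear_\<Gamma> nilpotent [OF *(1)], of i]]
    by (simp add: x_def)
  moreover have "(y, b) \<in> \<Gamma>'"
    using linear_operator_diff [OF linear_\<Gamma>' *(2)
        linear_operator_scale [OF linear_\<Gamma>' B\<^sub>2B\<^sub>1_into_null [OF *(2)], of i]]
    by (simp add: y_def)
  ultimately have D: "((x, y), (b, c)) \<in> D" by (simp add: off_diagonal_iff)
  have eq: "z *\<^sub>C (x, y) - map_prod B\<^sub>1 B\<^sub>2 (b, c) = (f, B\<^sub>2 f)"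
    by (simp add: scaleC_prod_def x_def y_def f_def *(3) complex_vector.scale_right_diff_distrib
        scaleC_scaleC i scaleC_one clinear_diff clinear_add clinear_scale linear_B algebra_simps)
  have M0: "0 < M" using M by simp
  note est = accretive_estimate [OF symmetric_D [OF D] accretive_block [OF D] norm_block \<delta>(1) M0
      less_imp_le [OF cone [unfolded k_def]], folded k_def, unfolded eq]
  have "norm c \<le> M * norm (b, c)"
    using norm_snd_le [of c b] mult_right_mono [OF M, of "norm (b, c)"] by simp
  then have c: "norm c \<le> (1 + k) * norm (f, B\<^sub>2 f)"
    using est(1) by simp
  have x: "cmod z * norm x \<le> (2 + k) * norm (f, B\<^sub>2 f)"
    using est(2) mult_left_mono [OF norm_fst_le [of x y], of "cmod z"] by simp
  have "z *\<^sub>C u = z *\<^sub>C x + c"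
    by (simp add: x_def complex_vector.scale_right_diff_distrib scaleC_scaleC i scaleC_one)
  then have "cmod z * norm u \<le> cmod z * norm x + norm c"
    by (metis norm_scaleC norm_triangle_ineq)
  also have "\<dots> \<le> (3 + 2 * k) * norm (f, B\<^sub>2 f)"
    using x c by (simp add: algebra_simps)
  also have "\<dots> \<le> (3 + 2 * k) * ((1 + M) * norm f)"
    using k_pos by (intro mult_left_mono norm_graph_le) auto
  finally show ?thesis by (simp add: f_def mult.assoc)
qed

lemma bisectorial_\<Pi>\<^sub>B: "bisectorial \<Pi>\<^sub>B"
  using k_pos M
  by (intro bisectorialI [OF linear_\<Pi>\<^sub>B _ \<Pi>\<^sub>B_onto \<Pi>\<^sub>B_estimate]) auto

lemma norm_le_B\<^sub>2:
  assumes "(x, c) \<in> \<Gamma>"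
  shows "\<delta> * norm c \<le> norm (B\<^sub>2 c)"
proof -
  have "\<delta> * (norm c)\<^sup>2 \<le> norm (B\<^sub>2 c) * norm c"
    using accretive_B\<^sub>2 [OF assms] complex_Re_le_cmod [of "cinner (B\<^sub>2 c) c"]
      norm_cinner_le [of "B\<^sub>2 c" c] by linarith
  then have "(\<delta> * norm c) * norm c \<le> norm (B\<^sub>2 c) * norm c"
    by (simp add: power2_eq_square mult.assoc)
  then show ?thesis by (cases "c = 0") auto
qed

text \<open>
  If \<open>(x, y)\<close> solves \<open>(1 + t\<^sup>2(BD)\<^sup>2)(x, y) = (f, B\<^sub>2 f)\<close>, then \<open>u = x - t\<^sup>2\<Gamma>B\<^sub>1\<Gamma>\<^sup>*y\<close> solves
  \<open>(1 + t\<^sup>2\<Pi>\<^sub>B\<^sup>2)u = f\<close> with \<open>\<Gamma>u = \<Gamma>x\<close> and \<open>\<Gamma>\<^sup>*B\<^sub>2u = \<Gamma>\<^sup>*y\<close>.  The comparison constant \<open>\<alpha>\<close> is put inside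
  the argument, by linearity, so that the inequality can be integrated by monotonicity, which holds
  for arbitrary integrands.
\<close>

lemma quadratic_op_\<Pi>\<^sub>B_le:
  assumes BD: "bisectorial BD" and t: "0 < t"
  defines "\<alpha> \<equiv> complex_of_real (1 + 1 / \<delta>)"
  shows "norm (quadratic_op \<Pi>\<^sub>B t f) \<le> norm (quadratic_op BD t (\<alpha> *\<^sub>C (f, B\<^sub>2 f)))"
proof -
  define s where "s = complex_of_real (t\<^sup>2)"
  have linear_BD: "linear_operator BD" using BD by (simp add: bisectorial_def)
  obtain P V W where PVW: "(P, V) \<in> BD" "(V, W) \<in> BD" "P + s *\<^sub>C W = (f, B\<^sub>2 f)"
    using exists_square_resolvent [OF BD t, of "(f, B\<^sub>2 f)"] unfolding s_def by metis
  obtain x y b c b' c' where *: "P = (x, y)" "V = (B\<^sub>1 b, B\<^sub>2 c)" "W = (B\<^sub>1 b', B\<^sub>2 c')"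
    "(y, b) \<in> \<Gamma>'" "(x, c) \<in> \<Gamma>" "(B\<^sub>2 c, b') \<in> \<Gamma>'" "(B\<^sub>1 b, c') \<in> \<Gamma>"
    using PVW(1,2) by (cases P; cases V; cases W) (auto simp: BD_iff)
  have f: "f = x + s *\<^sub>C B\<^sub>1 b'" and B\<^sub>2f: "B\<^sub>2 f = y + s *\<^sub>C B\<^sub>2 c'"
    using PVW(3) by (auto simp: * scaleC_prod_def)
  have "\<alpha> *\<^sub>C P + s *\<^sub>C (\<alpha> *\<^sub>C W) = \<alpha> *\<^sub>C (f, B\<^sub>2 f)"
    unfolding PVW(3) [symmetric] by (simp add: scaleC_add_right scaleC_scaleC mult.commute)
  then have Q_BD: "quadratic_op BD t (\<alpha> *\<^sub>C (f, B\<^sub>2 f)) = of_real t *\<^sub>C (\<alpha> *\<^sub>C V)"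
    using quadratic_op_eq [OF BD t linear_operator_scale [OF linear_BD PVW(1), of \<alpha>]
        linear_operator_scale [OF linear_BD PVW(2), of \<alpha>]]
    by (simp only: s_def)
  define u v w where "u = x - s *\<^sub>C c'" and "v = c + B\<^sub>1 b" and "w = c' + B\<^sub>1 b'"
  have "(u, c) \<in> \<Gamma>"
    using linear_operator_diff [OF linear_\<Gamma> *(5) linear_operator_scale [OF linear_\<Gamma> nilpotent [OF *(7)], of s]]
    by (simp add: u_def)
  moreover have "B\<^sub>2 u = y - s *\<^sub>C B\<^sub>2 (B\<^sub>1 b')"
    using B\<^sub>2f unfolding f
    by (simp add: u_def clinear_add clinear_diff clinear_scale linear_B algebra_simps)
  then have "(B\<^sub>2 u, b) \<in> \<Gamma>'"
    using linear_operator_diff [OF linear_\<Gamma>' *(4)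
        linear_operator_scale [OF linear_\<Gamma>' B\<^sub>2B\<^sub>1_into_null [OF *(6)], of s]]
    by simp
  ultimately have uv: "(u, v) \<in> \<Pi>\<^sub>B" unfolding \<Pi>\<^sub>B_iff v_def by blast
  have "(v, c') \<in> \<Gamma>"
    using linear_operator_add [OF linear_\<Gamma> nilpotent [OF *(5)] *(7)] by (simp add: v_def)
  moreover have "(B\<^sub>2 v, b') \<in> \<Gamma>'"
    using linear_operator_add [OF linear_\<Gamma>' *(6) B\<^sub>2B\<^sub>1_into_null [OF *(4)]]
    by (simp add: v_def clinear_add linear_B)
  ultimately have vw: "(v, w) \<in> \<Pi>\<^sub>B" unfolding \<Pi>\<^sub>B_iff w_def by blast
  have "u + s *\<^sub>C w = f"
    by (simp add: u_def w_def f scaleC_add_right)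
  then have Q: "quadratic_op \<Pi>\<^sub>B t f = of_real t *\<^sub>C v"
    using quadratic_op_eq [OF bisectorial_\<Pi>\<^sub>B t uv vw] by (simp only: s_def)
  have "norm c \<le> 1 / \<delta> * norm (B\<^sub>2 c)"
    using norm_le_B\<^sub>2 [OF *(5)] \<delta> by (simp add: field_simps)
  also have "\<dots> \<le> 1 / \<delta> * norm V"
    using norm_snd_le [of "B\<^sub>2 c" "B\<^sub>1 b"] \<delta> by (intro mult_left_mono) (auto simp: *)
  finally have "norm v \<le> (1 + 1 / \<delta>) * norm V"
    using norm_triangle_ineq [of c "B\<^sub>1 b"] norm_fst_le [of "B\<^sub>1 b" "B\<^sub>2 c"] by (simp add: v_def * algebra_simps)
  also have "(1 + 1 / \<delta>) = cmod \<alpha>"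
    unfolding \<alpha>_def norm_of_real using \<delta> by simp
  finally have "t * norm v \<le> t * (cmod \<alpha> * norm V)"
    using t by (intro mult_left_mono) auto
  then show ?thesis
    using t by (simp only: Q Q_BD norm_scaleC norm_of_real abs_of_pos)
qed

lemma quadratic_estimates_\<Pi>\<^sub>B:
  assumes "quadratic_estimates BD"
  shows "quadratic_estimates \<Pi>\<^sub>B"
proof -
  from assms obtain C where BD: "bisectorial BD" and C: "\<And>F.
      (\<integral>\<^sup>+t\<in>{0<..}. ennreal ((norm (quadratic_op BD t F))\<^sup>2 / t) \<partial>lborel) \<le> ennreal (C * (norm F)\<^sup>2)"
    unfolding quadratic_estimates_def by blast
  define \<alpha> where "\<alpha> = complex_of_real (1 + 1 / \<delta>)"
  define K where "K = cmod \<alpha> * (1 + M)"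
  have "(\<integral>\<^sup>+t\<in>{0<..}. ennreal ((norm (quadratic_op \<Pi>\<^sub>B t f))\<^sup>2 / t) \<partial>lborel)
      \<le> ennreal (max C 0 * K\<^sup>2 * (norm f)\<^sup>2)" for f
  proof -
    let ?F = "\<alpha> *\<^sub>C (f, B\<^sub>2 f)"
    have "(\<integral>\<^sup>+t\<in>{0<..}. ennreal ((norm (quadratic_op \<Pi>\<^sub>B t f))\<^sup>2 / t) \<partial>lborel)
        \<le> (\<integral>\<^sup>+t\<in>{0<..}. ennreal ((norm (quadratic_op BD t ?F))\<^sup>2 / t) \<partial>lborel)"
      using quadratic_op_\<Pi>\<^sub>B_le [OF BD, folded \<alpha>_def]
      by (intro nn_integral_mono)
        (auto simp: indicator_def intro!: ennreal_leI divide_right_mono power_mono)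
    also have "\<dots> \<le> ennreal (C * (norm ?F)\<^sup>2)" by (rule C)
    also have "\<dots> \<le> ennreal (max C 0 * (norm ?F)\<^sup>2)"
      by (intro ennreal_leI mult_right_mono) auto
    also have "\<dots> \<le> ennreal (max C 0 * (K * norm f)\<^sup>2)"
      using mult_left_mono [OF norm_graph_le [of f], of "cmod \<alpha>"]
      by (intro ennreal_leI mult_left_mono power_mono) (auto simp: norm_scaleC K_def mult.assoc)
    finally show ?thesis by (simp add: power_mult_distrib mult.assoc)
  qed
  with bisectorial_\<Pi>\<^sub>B show ?thesis
    unfolding quadratic_estimates_def by blast
qed

end

section \<open>Bisectoriality and quadratic estimates\<close>

theorem proposition10p1:
  fixes \<Gamma> :: "'a::complex_hilbert rel" and B\<^sub>1 B\<^sub>2 :: "'a \<Rightarrow> 'a"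
  defines "\<Gamma>' \<equiv> op_adjoint \<Gamma>"
  defines "\<Pi>\<^sub>B \<equiv> \<Gamma> \<oplus>\<^sub>o op_of B\<^sub>1 \<circ>\<^sub>o \<Gamma>' \<circ>\<^sub>o op_of B\<^sub>2"
  defines "D \<equiv> op_block (zero_on UNIV) \<Gamma>' \<Gamma> (zero_on UNIV)"
  defines "B \<equiv> op_block (op_of B\<^sub>1) (zero_on UNIV) (zero_on UNIV) (op_of B\<^sub>2)"
  assumes "closed_densely_defined \<Gamma>"
    and "\<Gamma> \<circ>\<^sub>o \<Gamma> = zero_on (Domain \<Gamma>)"
    and "\<Gamma>' \<circ>\<^sub>o \<Gamma>' = zero_on (Domain \<Gamma>')"
    and "bounded_operator B\<^sub>1"
    and "bounded_operator B\<^sub>2"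
    and "strictly_accretive_on B\<^sub>1 (Range \<Gamma>')"
    and "strictly_accretive_on B\<^sub>2 (Range \<Gamma>)"
    and "\<Gamma>' \<circ>\<^sub>o op_of B\<^sub>2 \<circ>\<^sub>o op_of B\<^sub>1 \<circ>\<^sub>o \<Gamma>' = zero_on (Domain \<Gamma>')"
    and "\<Gamma> \<circ>\<^sub>o op_of B\<^sub>1 \<circ>\<^sub>o op_of B\<^sub>2 \<circ>\<^sub>o \<Gamma> = zero_on (Domain \<Gamma>)"
  shows "bisectorial \<Pi>\<^sub>B \<and> (quadratic_estimates (B \<circ>\<^sub>o D) \<longrightarrow> quadratic_estimates \<Pi>\<^sub>B)"
proof -
  obtain K\<^sub>1 K\<^sub>2 where K: "\<And>x. norm (B\<^sub>1 x) \<le> K\<^sub>1 * norm x" "\<And>x. norm (B\<^sub>2 x) \<le> K\<^sub>2 * norm x"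
    using assms(8,9) unfolding bounded_operator_def by blast
  obtain \<delta>\<^sub>1 \<delta>\<^sub>2 where \<delta>: "\<delta>\<^sub>1 > 0" "\<And>b. b \<in> Range \<Gamma>' \<Longrightarrow> \<delta>\<^sub>1 * (norm b)\<^sup>2 \<le> Re (cinner (B\<^sub>1 b) b)"
    "\<delta>\<^sub>2 > 0" "\<And>c. c \<in> Range \<Gamma> \<Longrightarrow> \<delta>\<^sub>2 * (norm c)\<^sup>2 \<le> Re (cinner (B\<^sub>2 c) c)"
    using assms(10,11) unfolding strictly_accretive_on_def by blast
  define M \<delta> where "M = max 1 (max K\<^sub>1 K\<^sub>2)" and "\<delta> = min 1 (min \<delta>\<^sub>1 \<delta>\<^sub>2)"
  have lin: "linear_operator \<Gamma>" "linear_operator \<Gamma>'"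
    using assms(5) linear_operator_adjoint by (auto simp: closed_densely_defined_def \<Gamma>'_def)
  have MK: "K\<^sub>1 * norm x \<le> M * norm x" "K\<^sub>2 * norm x \<le> M * norm x" for x :: 'a
    by (auto simp: M_def intro!: mult_right_mono)
  have \<delta>_le: "\<delta> * (norm x)\<^sup>2 \<le> \<delta>\<^sub>1 * (norm x)\<^sup>2" "\<delta> * (norm x)\<^sup>2 \<le> \<delta>\<^sub>2 * (norm x)\<^sup>2" for x :: 'a
    by (auto simp: \<delta>_def intro!: mult_right_mono)
  interpret perturbed_dirac \<Gamma> B\<^sub>1 B\<^sub>2 \<delta> M
  proof (rule perturbed_dirac.intro)
    show "Vector_Spaces.linear scaleC scaleC B\<^sub>1" "Vector_Spaces.linear scaleC scaleC B\<^sub>2"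
      using assms(8,9) unfolding bounded_operator_def by blast+
    show "norm (B\<^sub>1 x) \<le> M * norm x" "norm (B\<^sub>2 x) \<le> M * norm x" for x
      using K MK order_trans by blast+
    show "\<delta> * (norm b)\<^sup>2 \<le> Re (cinner (B\<^sub>1 b) b)" if "(y, b) \<in> op_adjoint \<Gamma>" for y b
      using \<delta>(2) [of b] \<delta>_le(1) [of b] that by (force simp: \<Gamma>'_def)
    show "\<delta> * (norm c)\<^sup>2 \<le> Re (cinner (B\<^sub>2 c) c)" if "(x, c) \<in> \<Gamma>" for x c
      using \<delta>(4) [of c] \<delta>_le(2) [of c] that by force
    show "(c, 0) \<in> \<Gamma>" if "(x, c) \<in> \<Gamma>" for x c
    proof -
      have "(x, 0) \<in> \<Gamma> \<circ>\<^sub>o \<Gamma>"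
        unfolding assms(6) using that by (auto simp: zero_on_def)
      then show ?thesis
        using linear_operator_unique [OF lin(1) that] by (auto simp: op_comp_def)
    qed
    show "(B\<^sub>2 (B\<^sub>1 b), 0) \<in> op_adjoint \<Gamma>" if "(y, b) \<in> op_adjoint \<Gamma>" for y b
    proof -
      have "(y, 0) \<in> \<Gamma>' \<circ>\<^sub>o op_of B\<^sub>2 \<circ>\<^sub>o op_of B\<^sub>1 \<circ>\<^sub>o \<Gamma>'"
        unfolding assms(12) using that by (auto simp: zero_on_def \<Gamma>'_def)
      then show ?thesis
        using linear_operator_unique [OF lin(2)] that by (auto simp: op_comp_def op_of_def \<Gamma>'_def)
    qed
  qed (use assms(5) \<delta> in \<open>auto simp: M_def \<delta>_def\<close>)
  show ?thesis
    using bisectorial_\<Pi>\<^sub>B quadratic_estimates_\<Pi>\<^sub>B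
    unfolding \<Pi>\<^sub>B_def B_def D_def \<Gamma>'_def op_block_diagonal by blast
qed

end
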